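(* Let $N\ge 0$ be an integer and let $a,b,d,e,\mu$ be nonzero complex numbers. For $x=\frac12\bigl(t+\mu^{-1}t^{-1}\bigr)$, $t\in\mathbb C\setminus\{0\}$ (i.e. $t=e^{\xi}$), put $$U_n(x)={}_{10}W_9\Bigl(a;\,bt^{-1},\,\mu bt,\,d,\,e,\,aq^{N+1},\,\tfrac{a^2q^{1-N+n}}{\mu b^2de},\,q^{-n};q\Bigr),$$ $$V_m(x)={}_{10}W_9\Bigl(\tfrac{aq^{1-N}}{de};\,bt^{-1},\,\mu bt,\,\tfrac{q^{1-N}}{d},\,\tfrac{q^{1-N}}{e},\,\tfrac{aq^2}{de},\,\tfrac{a^2q^{1-N+m}}{\mu b^2de},\,q^{-m};q\Bigr).$$ Then $$\sum_{k=0}^N U_n(x_k)V_m(x_k)\,r_k=C_n\,\delta_{n,m},\qquad 0\le n,m\le N,$$ where $x_k=\frac12\bigl(bq^k+\frac{q^{-k}}{b\mu}\bigr)$, $$r_k=q^k\,\frac{\bigl(\mu b^2,\,q\sqrt{\mu b^2},\,-q\sqrt{\mu b^2},\,\frac{\mu b^2}{a},\,\frac{aq}{d},\,\frac{aq}{e},\,\frac{\mu b^2de}{a}q^{N-1},\,q^{-N}\bigr)_k}{\bigl(\sqrt{\mu b^2},\,-\sqrt{\mu b^2},\,aq,\,\frac{\mu b^2d}{a},\,\frac{\mu b^2e}{a},\,\mu b^2q^{N+1},\,\frac{aq^{2-N}}{de},\,q\bigr)_k}\;\frac{\bigl(aq,\frac{\mu b^2d}{a},\frac{\mu b^2e}{a},\frac{de}{aq}\bigr)_N}{\bigl(\mu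 b^2q,\,d,\,e,\,\frac{\mu b^2de}{a^2q}\bigr)_N},$$ $$C_n=q^{-n}\,\frac{\bigl(q,\frac{aq^{1-N}}{\mu b^2d},\frac{aq^{1-N}}{\mu b^2e},\frac{a^2q^2}{\mu b^2de},\frac{aq^{2-N}}{de},aq\bigr)_n}{\bigl(q^{-N},\frac{aq^{1-N}}{\mu b^2de},\frac{aq}{d},\frac{aq}{e},\frac{a}{\mu b^2},\frac{a^2q^{2-N}}{\mu b^2de}\bigr)_n}\;\frac{1-\frac{a^2q^{1-N+n}}{\mu b^2de}}{1-\frac{a^2q^{1-N+2n}}{\mu b^2de}} .$$
   Context: Throughout $q\in\mathbb C$, $0<|q|<1$; $(x)_0=1$, $(x)_k=\prod_{j=0}^{k-1}(1-xq^j)$, $(x_1,\dots,x_r)_k=\prod_i (x_i)_k$. Here $e$ is a complex parameter (not Euler's number). The balanced very-well-poised series is $${}_{10}W_9(a;p_1,\dots,p_7;q)=\sum_{k\ge 0} \frac{1-aq^{2k}}{1-a}\,\frac{(a,p_1,\dots,p_7)_k}{(q,aq/p_1,\dots,aq/p_7)_k}\,q^k,\qquad p_1\cdots p_7=a^3q^2;$$ when one of the $p_i$ is $q^{-n}$ the sum runs over $0\le k\le n$. $U_n$ and $V_m$ are invariant under $t\mapsto 1/(\mu t)$, hence are functions of $x$; at $x=x_k$ one takes $t=bq^k$. Standing assumption: parameters are such that no zero denominators occur. *)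

theory Defs
  imports Complex_Main
begin

definition qpoch :: "complex \<Rightarrow> complex \<Rightarrow> nat \<Rightarrow> complex" where
  "qpoch q x k = (\<Prod>j<k. 1 - x * q ^ j)"

definition qpochs :: "complex \<Rightarrow> complex list \<Rightarrow> nat \<Rightarrow> complex" where
  "qpochs q xs k = (\<Prod>x\<leftarrow>xs. qpoch q x k)"

text \<open>
  The very-well-poised series; for \<open>10W9\<close> the list \<open>ps\<close> has seven entries with product
  \<open>a^3 q^2\<close>, which is checked for the two instances below. If \<open>q powi (-n)\<close> is among the
  parameters, all terms with index greater than \<open>n\<close> have a vanishing numerator, so that the
  series is the sum over \<open>k \<le> n\<close>; see \<open>W109_terminating\<close>.
\<close>

definition W109 :: "complex \<Rightarrow> complex \<Rightarrow> complex list \<Rightarrow> complex" where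
  "W109 q a ps = (\<Sum>k. (1 - a * q ^ (2 * k)) / (1 - a) *
     (qpochs q (a # ps) k / qpochs q (q # map (\<lambda>p. a * q / p) ps) k) * q ^ k)"

definition W109_defined :: "complex \<Rightarrow> nat \<Rightarrow> complex \<Rightarrow> complex list \<Rightarrow> bool" where
  "W109_defined q n a ps \<longleftrightarrow>
     1 - a \<noteq> 0 \<and> (\<forall>k\<le>n. qpochs q (q # map (\<lambda>p. a * q / p) ps) k \<noteq> 0)"

definition U_params ::
  "complex \<Rightarrow> nat \<Rightarrow> complex \<Rightarrow> complex \<Rightarrow> complex \<Rightarrow> complex \<Rightarrow> complex \<Rightarrow> nat \<Rightarrow> complex \<Rightarrow> complex list" where
  "U_params q N a b d e \<mu> n t =
     [b / t, \<mu> * b * t, d, e, a * q ^ (N + 1),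
      a^2 * q powi (1 - int N + int n) / (\<mu> * b^2 * d * e), q powi (- int n)]"

definition V_base :: "complex \<Rightarrow> nat \<Rightarrow> complex \<Rightarrow> complex \<Rightarrow> complex \<Rightarrow> complex" where
  "V_base q N a d e = a * q powi (1 - int N) / (d * e)"

definition V_params ::
  "complex \<Rightarrow> nat \<Rightarrow> complex \<Rightarrow> complex \<Rightarrow> complex \<Rightarrow> complex \<Rightarrow> complex \<Rightarrow> nat \<Rightarrow> complex \<Rightarrow> complex list" where
  "V_params q N a b d e \<mu> m t =
     [b / t, \<mu> * b * t, q powi (1 - int N) / d, q powi (1 - int N) / e, a * q^2 / (d * e),
      a^2 * q powi (1 - int N + int m) / (\<mu> * b^2 * d * e), q powi (- int m)]"

definition x_of :: "complex \<Rightarrow> complex \<Rightarrow> complex" where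
  "x_of \<mu> t = (t + 1 / (\<mu> * t)) / 2"

text \<open>
  \<open>U\<close> and \<open>V\<close> are functions of \<open>x\<close>: an arbitrary \<open>t \<noteq> 0\<close> with \<open>x = x_of \<mu> t\<close> is chosen.
  By \<open>U_x_of\<close> and \<open>V_x_of\<close> the value does not depend on the choice.
\<close>

definition t_of :: "complex \<Rightarrow> complex \<Rightarrow> complex" where
  "t_of \<mu> x = (SOME t. t \<noteq> 0 \<and> x_of \<mu> t = x)"

definition U ::
  "complex \<Rightarrow> nat \<Rightarrow> complex \<Rightarrow> complex \<Rightarrow> complex \<Rightarrow> complex \<Rightarrow> complex \<Rightarrow> nat \<Rightarrow> complex \<Rightarrow> complex" where
  "U q N a b d e \<mu> n x = W109 q a (U_params q N a b d e \<mu> n (t_of \<mu> x))"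

definition V ::
  "complex \<Rightarrow> nat \<Rightarrow> complex \<Rightarrow> complex \<Rightarrow> complex \<Rightarrow> complex \<Rightarrow> complex \<Rightarrow> nat \<Rightarrow> complex \<Rightarrow> complex" where
  "V q N a b d e \<mu> m x = W109 q (V_base q N a d e) (V_params q N a b d e \<mu> m (t_of \<mu> x))"

text \<open>The denominators of the weights and of the norming constants are named because they
  reappear in \<open>no_zero_denominators\<close>. Only \<open>\<plusminus>csqrt (\<mu> * b^2)\<close> as a pair enters, so the choice
  of the branch is immaterial.\<close>

definition r_den ::
  "complex \<Rightarrow> nat \<Rightarrow> complex \<Rightarrow> complex \<Rightarrow> complex \<Rightarrow> complex \<Rightarrow> complex \<Rightarrow> complex list" where
  "r_den q N a b d e \<mu> =
     [csqrt (\<mu> * b^2), - csqrt (\<mu> * b^2), a * q, \<mu> * b^2 * d / a, \<mu> * b^2 * e / a,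
      \<mu> * b^2 * q ^ (N + 1), a * q powi (2 - int N) / (d * e), q]"

definition r_den_N ::
  "complex \<Rightarrow> complex \<Rightarrow> complex \<Rightarrow> complex \<Rightarrow> complex \<Rightarrow> complex \<Rightarrow> complex list" where
  "r_den_N q a b d e \<mu> = [\<mu> * b^2 * q, d, e, \<mu> * b^2 * d * e / (a^2 * q)]"

definition r ::
  "complex \<Rightarrow> nat \<Rightarrow> complex \<Rightarrow> complex \<Rightarrow> complex \<Rightarrow> complex \<Rightarrow> complex \<Rightarrow> nat \<Rightarrow> complex" where
  "r q N a b d e \<mu> k =
     q ^ k *
     (qpochs q [\<mu> * b^2, q * csqrt (\<mu> * b^2), - q * csqrt (\<mu> * b^2), \<mu> * b^2 / a,
                a * q / d, a * q / e, \<mu> * b^2 * d * e / a * q powi (int N - 1),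
                q powi (- int N)] k
      / qpochs q (r_den q N a b d e \<mu>) k) *
     (qpochs q [a * q, \<mu> * b^2 * d / a, \<mu> * b^2 * e / a, d * e / (a * q)] N
      / qpochs q (r_den_N q a b d e \<mu>) N)"

definition C_den ::
  "complex \<Rightarrow> nat \<Rightarrow> complex \<Rightarrow> complex \<Rightarrow> complex \<Rightarrow> complex \<Rightarrow> complex \<Rightarrow> complex list" where
  "C_den q N a b d e \<mu> =
     [q powi (- int N), a * q powi (1 - int N) / (\<mu> * b^2 * d * e), a * q / d, a * q / e,
      a / (\<mu> * b^2), a^2 * q powi (2 - int N) / (\<mu> * b^2 * d * e)]"

definition C_den_factor ::
  "complex \<Rightarrow> nat \<Rightarrow> complex \<Rightarrow> complex \<Rightarrow> complex \<Rightarrow> complex \<Rightarrow> complex \<Rightarrow> nat \<Rightarrow> complex" where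
  "C_den_factor q N a b d e \<mu> n =
     1 - a^2 * q powi (1 - int N + 2 * int n) / (\<mu> * b^2 * d * e)"

definition C ::
  "complex \<Rightarrow> nat \<Rightarrow> complex \<Rightarrow> complex \<Rightarrow> complex \<Rightarrow> complex \<Rightarrow> complex \<Rightarrow> nat \<Rightarrow> complex" where
  "C q N a b d e \<mu> n =
     q powi (- int n) *
     (qpochs q [q, a * q powi (1 - int N) / (\<mu> * b^2 * d), a * q powi (1 - int N) / (\<mu> * b^2 * e),
                a^2 * q^2 / (\<mu> * b^2 * d * e), a * q powi (2 - int N) / (d * e), a * q] n
      / qpochs q (C_den q N a b d e \<mu>) n) *
     ((1 - a^2 * q powi (1 - int N + int n) / (\<mu> * b^2 * d * e))
      / C_den_factor q N a b d e \<mu> n)"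

definition no_zero_denominators ::
  "complex \<Rightarrow> nat \<Rightarrow> complex \<Rightarrow> complex \<Rightarrow> complex \<Rightarrow> complex \<Rightarrow> complex \<Rightarrow> bool" where
  "no_zero_denominators q N a b d e \<mu> \<longleftrightarrow>
     (\<forall>n\<le>N. \<forall>k\<le>N. W109_defined q n a (U_params q N a b d e \<mu> n (b * q ^ k))) \<and>
     (\<forall>m\<le>N. \<forall>k\<le>N.
        W109_defined q m (V_base q N a d e) (V_params q N a b d e \<mu> m (b * q ^ k))) \<and>
     (\<forall>k\<le>N. qpochs q (r_den q N a b d e \<mu>) k \<noteq> 0) \<and>
     qpochs q (r_den_N q a b d e \<mu>) N \<noteq> 0 \<and>
     (\<forall>n\<le>N. qpochs q (C_den q N a b d e \<mu>) n \<noteq> 0 \<and> C_den_factor q N a b d e \<mu> n \<noteq> 0)"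

lemma qpoch_terminating:
  assumes "q \<noteq> 0" "n < k"
  shows "qpoch q (q powi (- int n)) k = 0"
proof -
  have "1 - q powi (- int n) * q ^ n = 0"
    using assms(1) by (simp add: power_int_minus)
  then show ?thesis
    unfolding qpoch_def using assms(2) by (intro prod_zero) auto
qed

lemma W109_terminating:
  assumes "q \<noteq> 0" "q powi (- int n) \<in> set ps"
  shows "W109 q a ps = (\<Sum>k\<le>n. (1 - a * q ^ (2 * k)) / (1 - a) *
     (qpochs q (a # ps) k / qpochs q (q # map (\<lambda>p. a * q / p) ps) k) * q ^ k)"
proof -
  have "qpochs q (a # ps) k = 0" if "k \<notin> {..n}" for k
  proof -
    have "qpoch q (q powi (- int n)) k = 0"
      using that assms(1) by (intro qpoch_terminating) auto
    then show ?thesis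
      using assms(2) by (force simp: qpochs_def prod_list_zero_iff)
  qed
  then show ?thesis
    unfolding W109_def by (intro suminf_finite) auto
qed

lemma U_params_balanced:
  assumes "q \<noteq> 0" "a \<noteq> 0" "b \<noteq> 0" "d \<noteq> 0" "e \<noteq> 0" "\<mu> \<noteq> 0" "t \<noteq> 0"
  shows "prod_list (U_params q N a b d e \<mu> n t) = a^3 * q^2"
  using assms
  by (simp add: U_params_def power_int_add power_int_diff power_int_minus field_simps
      power2_eq_square power3_eq_cube)

lemma V_params_balanced:
  assumes "q \<noteq> 0" "a \<noteq> 0" "b \<noteq> 0" "d \<noteq> 0" "e \<noteq> 0" "\<mu> \<noteq> 0" "t \<noteq> 0"
  shows "prod_list (V_params q N a b d e \<mu> m t) = V_base q N a d e ^ 3 * q^2"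
  using assms
  by (simp add: V_params_def V_base_def power_int_add power_int_diff power_int_minus field_simps
      power2_eq_square power3_eq_cube)

lemma t_of_x_of:
  assumes "\<mu> \<noteq> 0" "t \<noteq> 0"
  shows "t_of \<mu> (x_of \<mu> t) = t \<or> t_of \<mu> (x_of \<mu> t) = 1 / (\<mu> * t)"
proof -
  define s where "s = t_of \<mu> (x_of \<mu> t)"
  have s: "s \<noteq> 0" "x_of \<mu> s = x_of \<mu> t"
    using someI[of "\<lambda>s. s \<noteq> 0 \<and> x_of \<mu> s = x_of \<mu> t" t] assms
    by (auto simp: s_def t_of_def)
  have "(s - t) * (\<mu> * t * s - 1) = \<mu> * t * s * ((s + 1 / (\<mu> * s)) - (t + 1 / (\<mu> * t)))"
    using s(1) assms by (simp add: field_simps)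
  also have "\<dots> = 0"
    using s(2) unfolding x_of_def divide_cancel_right by simp
  finally have "(s - t) * (\<mu> * t * s - 1) = 0" .
  then have "s = t \<or> \<mu> * t * s = 1"
    unfolding mult_eq_0_iff by simp
  then have "s = t \<or> s = 1 / (\<mu> * t)"
    using assms by (simp add: eq_divide_eq mult_ac)
  then show ?thesis by (simp add: s_def)
qed

lemma W109_swap: "W109 q a (x # y # ps) = W109 q a (y # x # ps)"
  by (simp add: W109_def qpochs_def mult_ac)

lemma U_x_of:
  assumes "\<mu> \<noteq> 0" "t \<noteq> 0"
  shows "U q N a b d e \<mu> n (x_of \<mu> t) = W109 q a (U_params q N a b d e \<mu> n t)"
  using t_of_x_of[OF assms] assms
  by (auto simp: U_def U_params_def mult_ac intro: W109_swap)

lemma V_x_of: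
  assumes "\<mu> \<noteq> 0" "t \<noteq> 0"
  shows "V q N a b d e \<mu> m (x_of \<mu> t) =
    W109 q (V_base q N a d e) (V_params q N a b d e \<mu> m t)"
  using t_of_x_of[OF assms] assms
  by (auto simp: V_def V_params_def mult_ac intro: W109_swap)

end

theory Submission
  imports Defs "HOL-Computational_Algebra.Polynomial"
begin

text \<open>
  Put \<open>A = \<mu> b\<^sup>2\<close> and \<open>f = a\<^sup>2 q\<^bsup>1-N\<^esup> / (A d e)\<close>. At \<open>x\<^sub>k\<close> the functions \<open>U\<^sub>n\<close> and \<open>V\<^sub>m\<close> are combinations of
  \<open>(q\<^bsup>-k\<^esup>, A q\<^sup>k)\<^sub>i / (c q\<^bsup>k+1\<^esup>, c q\<^bsup>1-k\<^esup> / A)\<^sub>i\<close> with \<open>c = a\<close> and \<open>c = a' = a q\<^bsup>1-N\<^esup> / (d e)\<close>. The products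
  of such functions are not summable against the weight, but a polynomial of degree \<open>n\<close> in \<open>x\<close> over
  \<open>(a q\<^bsup>k+1\<^esup>, a q\<^bsup>1-k\<^esup> / A)\<^sub>n\<close> can also be expanded in
  \<open>\<chi>\<^sub>i(k) = (q\<^bsup>k-N\<^esup>, q\<^bsup>-N-k\<^esup> / A)\<^sub>i / (a q\<^bsup>k+1\<^esup>, a q\<^bsup>1-k\<^esup> / A)\<^sub>i\<close>, \<open>i \<le> n\<close>, with the top coefficient read off at the
  root of the last denominator factor. Now \<open>\<chi>\<^sub>i\<close> times the \<open>j\<close>-th term of \<open>V\<^sub>m\<close> only shifts parameters of
  the very-well-poised weight, so its sum over \<open>k\<close> is given by Jackson's sum; the remaining sum over \<open>j\<close> is
  again a Jackson sum, and it contains a factor that vanishes for \<open>i < m\<close>. This settles \<open>n \<le> m\<close>. The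
  involution \<open>(a, d, e) \<mapsto> (a', q\<^bsup>1-N\<^esup> / d, q\<^bsup>1-N\<^esup> / e)\<close> exchanges \<open>U\<close> and \<open>V\<close> and fixes the weight, which
  settles \<open>n > m\<close>.
\<close>

section \<open>Jackson's sum\<close>

lemma qpoch_0 [simp]: "qpoch q x 0 = 1"
  by (simp add: qpoch_def)

lemma qpoch_Suc: "qpoch q x (Suc k) = qpoch q x k * (1 - x * q ^ k)"
  by (simp add: qpoch_def)

lemma qpoch_add: "qpoch q x (j + l) = qpoch q x j * qpoch q (x * q ^ j) l"
  by (induction l) (simp_all add: qpoch_Suc power_add mult_ac)

lemma qpoch_Suc_left: "qpoch q x (Suc k) = (1 - x) * qpoch q (x * q) k"
  using qpoch_add[of q x 1 k] by (simp add: qpoch_Suc)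

lemma qpoch_nz_iff: "qpoch q x k \<noteq> 0 \<longleftrightarrow> (\<forall>l<k. x * q ^ l \<noteq> 1)"
  by (auto simp: qpoch_def)

lemma qpoch_mono_nz: "qpoch q x k \<noteq> 0 \<Longrightarrow> l \<le> k \<Longrightarrow> qpoch q x l \<noteq> 0"
  by (auto simp: qpoch_nz_iff)

lemma qpochs_Cons: "qpochs q (x # xs) k = qpoch q x k * qpochs q xs k"
  by (simp add: qpochs_def)

lemma qpochs_Nil [simp]: "qpochs q [] k = 1"
  by (simp add: qpochs_def)

text \<open>The summand of \<open>W109\<close> with a parameter list of any length, so that
  parameters can be split off the very-well-poised term one at a time.\<close>

definition vwp :: "complex \<Rightarrow> complex \<Rightarrow> complex list \<Rightarrow> nat \<Rightarrow> complex" where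
  "vwp q a ps k = (1 - a * q ^ (2 * k)) / (1 - a) *
     (qpochs q (a # ps) k / qpochs q (q # map (\<lambda>p. a * q / p) ps) k) * q ^ k"

lemma vwp_Cons: "vwp q a (p # ps) k = vwp q a ps k * (qpoch q p k / qpoch q (a * q / p) k)"
  by (simp add: vwp_def qpochs_Cons mult_ac)

lemma vwp_Nil: "vwp q a [] k = (1 - a * q ^ (2 * k)) / (1 - a) * (qpoch q a k / qpoch q q k) * q ^ k"
  by (simp add: vwp_def qpochs_Cons)

text \<open>Here \<open>s1\<close>, \<open>s2\<close>, \<open>s3\<close> stand for the elementary
  symmetric functions of three parameters \<open>b\<close>, \<open>c\<close>, \<open>d\<close>; in
  them the identity is linear in \<open>s1\<close> and in \<open>s2\<close>.\<close>

lemma sixfold_identity_symmetric: fixes \<alpha> s1 s2 s3 E F K :: complex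
  assumes nz: "\<alpha> \<noteq> 0" "s3 \<noteq> 0" "E \<noteq> 0" and F: "F = \<alpha>^2 / (s3 * E)"
  shows "- (E/\<alpha>) * (1 - E/F) * ((1-\<alpha>*K)*(1 - s1*K + s2*K^2 - s3*K^3)*(1-E*K)*(1-F*K)
      - (1-K)*(1 - \<alpha>*s2/s3*K + \<alpha>^2*s1/s3*K^2 - \<alpha>^3/s3*K^3)*(1-\<alpha>*K/E)*(1-\<alpha>*K/F))
   = K*(1-\<alpha>*K^2)*( - (E/\<alpha>) * (1-F)*(1 - s2*\<alpha>/s3/F + s1*\<alpha>^2/s3/F^2 - \<alpha>^3/s3/F^3)*(1-E*K)*(1-\<alpha>*K/E)
      - (1-E)*(1 - s1*E/\<alpha> + s2*(E/\<alpha>)^2 - s3*(E/\<alpha>)^3)*(1-F*K)*(1-\<alpha>*K/F))"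
  unfolding F using nz by (simp add: divide_simps) algebra

text \<open>The certificate of the telescoping in \<open>jackson_step\<close>, with \<open>K = q\<^sup>k\<close>: the parameters \<open>\<alpha>, b, c, d, E, F\<close> are balanced.\<close>

lemma sixfold_identity: fixes \<alpha> b c d E F K :: complex
  assumes nz: "\<alpha> \<noteq> 0" "b \<noteq> 0" "c \<noteq> 0" "d \<noteq> 0" "E \<noteq> 0" and F: "F = \<alpha>^2 / (b * c * d * E)"
  shows "- (E/\<alpha>) * (1 - E/F) * ((1-\<alpha>*K)*((1-b*K)*(1-c*K)*(1-d*K))*(1-E*K)*(1-F*K)
      - (1-K)*((1-\<alpha>*K/b)*(1-\<alpha>*K/c)*(1-\<alpha>*K/d))*(1-\<alpha>*K/E)*(1-\<alpha>*K/F))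
   = K*(1-\<alpha>*K^2)*( - (E/\<alpha>) * (1-F)*((1-\<alpha>/(b*F))*(1-\<alpha>/(c*F))*(1-\<alpha>/(d*F)))*(1-E*K)*(1-\<alpha>*K/E)
      - (1-E)*((1-E*b/\<alpha>)*(1-E*c/\<alpha>)*(1-E*d/\<alpha>))*(1-F*K)*(1-\<alpha>*K/F))"
proof -
  define s1 s2 s3 where s: "s1 = b + c + d" "s2 = b*c + b*d + c*d" "s3 = b*c*d"
  have up: "(1-b*x)*(1-c*x)*(1-d*x) = 1 - s1*x + s2*x^2 - s3*x^3" for x
    unfolding s by algebra
  have down: "(1-\<alpha>*x/b)*(1-\<alpha>*x/c)*(1-\<alpha>*x/d) = 1 - \<alpha>*s2/s3*x + \<alpha>^2*s1/s3*x^2 - \<alpha>^3/s3*x^3" for x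
    unfolding s using nz by (simp add: divide_simps) algebra
  have down': "(1-\<alpha>/(b*F))*(1-\<alpha>/(c*F))*(1-\<alpha>/(d*F))
      = 1 - s2*\<alpha>/s3/F + s1*\<alpha>^2/s3/F^2 - \<alpha>^3/s3/F^3"
    using down[of "1/F"] by (simp add: mult_ac power_divide)
  have up': "(1-E*b/\<alpha>)*(1-E*c/\<alpha>)*(1-E*d/\<alpha>) = 1 - s1*E/\<alpha> + s2*(E/\<alpha>)^2 - s3*(E/\<alpha>)^3"
    using up[of "E/\<alpha>"] by (simp add: mult_ac)
  have "s3 \<noteq> 0" "F = \<alpha>^2 / (s3 * E)" using nz F by (auto simp: s)
  from sixfold_identity_symmetric[OF nz(1) this(1) nz(5) this(2)] show ?thesis
    unfolding up down down' up' by simp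
qed

text \<open>A contiguous relation. Raising \<open>n\<close> replaces the parameter pair
  \<open>E\<close>, \<open>F * q\<close> by \<open>E * q\<close>, \<open>F\<close>. The combination
  \<open>D * (1 - E/\<alpha>) * t (Suc n) k - N * t n k * (1 - \<alpha>/F)\<close> has closed
  partial sums \<open>H\<close>, and the top term of the longer series cancels
  \<open>H n\<close>.\<close>

lemma jackson_step:
  fixes q \<alpha> b c d l :: complex and n :: nat
  assumes nz: "q \<noteq> 0" "\<alpha> \<noteq> 0" "b \<noteq> 0" "c \<noteq> 0" "d \<noteq> 0" and l: "l = \<alpha>^2 * q / (b * c * d)"
    and q1: "qpoch q q (Suc n) \<noteq> 0"
    and \<alpha>1: "\<And>k. k \<le> 2 * Suc n \<Longrightarrow> \<alpha> * q ^ k \<noteq> 1"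
    and den: "qpoch q (\<alpha> * q / b) (Suc n) \<noteq> 0" "qpoch q (\<alpha> * q / c) (Suc n) \<noteq> 0"
      "qpoch q (\<alpha> * q / d) (Suc n) \<noteq> 0" "qpoch q (\<alpha> * q / (l * q ^ Suc n)) (Suc n) \<noteq> 0"
  defines "S \<equiv> \<lambda>n. \<Sum>k\<le>n. vwp q \<alpha> [b, c, d, l * q ^ n, 1 / q ^ n] k"
  shows "(1 - \<alpha> * q ^ Suc n / b) * (1 - \<alpha> * q ^ Suc n / c) * (1 - \<alpha> * q ^ Suc n / d) *
      (1 - \<alpha> * q ^ Suc n / (b * c * d)) * S (Suc n) =
    (1 - \<alpha> * q ^ Suc n) * (1 - \<alpha> * q ^ Suc n / (b * c)) * (1 - \<alpha> * q ^ Suc n / (b * d)) *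
      (1 - \<alpha> * q ^ Suc n / (c * d)) * S n"
proof -
  define E F where "E = l * q ^ n" and "F = 1 / q ^ Suc n"
  define D where "D = (1-\<alpha>/(b*F))*(1-\<alpha>/(c*F))*(1-\<alpha>/(d*F))"
  define N where "N = (1-E*b/\<alpha>)*(1-E*c/\<alpha>)*(1-E*d/\<alpha>)"
  define g where "g = - (E/\<alpha>) * (1 - E/F)"
  \<comment> \<open>\<open>M\<close> collects the factors free of \<open>E\<close> and
    \<open>F\<close>; in the numerators of \<open>R\<close> both \<open>E\<close> and
    \<open>F\<close> are raised.\<close>
  define M where "M k = qpoch q \<alpha> k * qpoch q b k * qpoch q c k * qpoch q d k /
    (qpoch q q k * qpoch q (\<alpha>*q/b) k * qpoch q (\<alpha>*q/c) k * qpoch q (\<alpha>*q/d) k)" for k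
  define R where "R k = qpoch q (E*q) k * qpoch q (F*q) k / (qpoch q (\<alpha>*q/E) k * qpoch q (\<alpha>*q/F) k)" for k
  define H where "H j = g * ((1-\<alpha>*q^j)*((1-b*q^j)*(1-c*q^j)*(1-d*q^j))) * M j / (1-\<alpha>) * R j" for j
  define t where "t n k = vwp q \<alpha> [b, c, d, l * q ^ n, 1 / q ^ n] k" for n k
  have E0: "E \<noteq> 0" "F \<noteq> 0" using nz l by (auto simp: E_def F_def)
  have Feq: "F = \<alpha>^2 / (b * c * d * E)" using nz l by (simp add: E_def F_def)
  have \<alpha>0: "1 - \<alpha> \<noteq> 0" using \<alpha>1[of 0] by auto
  have \<alpha>F: "1 - \<alpha> / F \<noteq> 0" using \<alpha>1[of "Suc n"] by (auto simp: F_def)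
  have \<alpha>Fk: "1 - \<alpha> * q ^ k / F \<noteq> 0" if "k \<le> Suc n" for k
    using \<alpha>1[of "k + Suc n"] that by (auto simp: F_def power_add mult_ac)
  have dE: "qpoch q (\<alpha> / E) (Suc n) \<noteq> 0"
    using den(4) nz by (simp add: E_def mult_ac)
  have \<alpha>E: "1 - \<alpha> / E \<noteq> 0" and \<alpha>Ek: "\<And>k. k \<le> n \<Longrightarrow> 1 - \<alpha> * q ^ k / E \<noteq> 0"
    using dE unfolding qpoch_nz_iff by (force, simp)
  have qk: "1 - q ^ Suc k \<noteq> 0" if "k \<le> n" for k
    using q1 that unfolding qpoch_nz_iff by auto
  have bk: "1 - \<alpha> * q ^ Suc k / b \<noteq> 0" "1 - \<alpha> * q ^ Suc k / c \<noteq> 0" "1 - \<alpha> * q ^ Suc k / d \<noteq> 0"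
    if "k \<le> n" for k
    using den that unfolding qpoch_nz_iff by (auto simp: mult_ac)
  have tn: "t n k = (1 - \<alpha> * q^(2*k)) / (1-\<alpha>) * M k * q^k *
      (qpoch q E k * qpoch q (F*q) k / (qpoch q (\<alpha>*q/E) k * qpoch q (\<alpha>/F) k))" for k
    using nz by (simp add: t_def vwp_def qpochs_Cons M_def E_def F_def mult_ac)
  have tn1: "t (Suc n) k = (1 - \<alpha> * q^(2*k)) / (1-\<alpha>) * M k * q^k *
      (qpoch q (E*q) k * qpoch q F k / (qpoch q (\<alpha>/E) k * qpoch q (\<alpha>*q/F) k))" for k
    using nz by (simp add: t_def vwp_def qpochs_Cons M_def E_def F_def mult_ac)
  have DE: "D * (1 - E/\<alpha>) = D * (- (E/\<alpha>) * (1 - \<alpha>/E))"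
    using nz E0 by (simp add: field_simps)
  have M_Suc: "M (Suc j) * ((1-q^Suc j)*((1-\<alpha>*q^Suc j/b)*(1-\<alpha>*q^Suc j/c)*(1-\<alpha>*q^Suc j/d))) =
      M j * ((1-\<alpha>*q^j)*((1-b*q^j)*(1-c*q^j)*(1-d*q^j)))" if "j \<le> n" for j
  proof -
    have 1: "M (Suc j) = M j * ((1-\<alpha>*q^j)*((1-b*q^j)*(1-c*q^j)*(1-d*q^j))) /
      ((1-q^Suc j)*((1-\<alpha>*q^Suc j/b)*(1-\<alpha>*q^Suc j/c)*(1-\<alpha>*q^Suc j/d)))"
      by (simp add: M_def qpoch_Suc mult_ac)
    have "(1-q^Suc j)*((1-\<alpha>*q^Suc j/b)*(1-\<alpha>*q^Suc j/c)*(1-\<alpha>*q^Suc j/d)) \<noteq> 0"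
      using qk[OF that] bk[OF that] by (simp del: power_Suc)
    from nonzero_eq_divide_eq[OF this, THEN iffD1, OF 1] show ?thesis .
  qed
  \<comment> \<open>\<open>H j\<close> is rewritten with \<open>M (Suc j)\<close>, so that it shares
    the factor \<open>M (Suc j) / (1-\<alpha>) * R j\<close> with both terms at
    \<open>Suc j\<close>.\<close>
  have HB: "H j = g * (M (Suc j) / (1-\<alpha>) * R j) *
       ((1-q^Suc j)*((1-\<alpha>*q^Suc j/b)*(1-\<alpha>*q^Suc j/c)*(1-\<alpha>*q^Suc j/d)))" if "j \<le> n" for j
  proof -
    have "H j = g * (M j * ((1-\<alpha>*q^j)*((1-b*q^j)*(1-c*q^j)*(1-d*q^j)))) / (1-\<alpha>) * R j"
      by (simp add: H_def)
    then show ?thesis unfolding M_Suc[OF that, symmetric] by simp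
  qed
  have pw: "q ^ (2 * k) = (q ^ k)\<^sup>2" for k
    by (simp add: power_mult[symmetric] mult.commute)
  have cancel1: "D * (x * y) * (a1 / b1 * m * k * (p1 * p2 * (u * p3) / (y * p4 * (p5 * w)))) =
      m / b1 * (p1 * p3 / (p4 * p5)) * (k * a1 * (x * u * D * p2) / w)"
    if "y \<noteq> 0" for x y a1 b1 m k p1 p2 p3 u p4 p5 w :: complex
    using that by (simp add: mult_ac)
  have cancel2: "N * (a1 / b1 * m * k * (x * p1 * (p3 * u) / (p4 * v * (y * p5)))) * y =
      m / b1 * (p1 * p3 / (p4 * p5)) * (k * a1 * (x * N * u) / v)"
    if "y \<noteq> 0" for x y a1 b1 m k p1 p3 u p4 p5 v :: complex
    using that by (simp add: mult_ac)
  have t'B: "D * (1 - E/\<alpha>) * t (Suc n) (Suc j) = (M (Suc j) / (1-\<alpha>) * R j) *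
      (q^Suc j * (1 - \<alpha> * (q^Suc j)^2) * (- (E/\<alpha>) * (1-F) * D * (1 - E * q^Suc j)) / (1 - \<alpha> * q^Suc j / F))"
    if "j \<le> n" for j
  proof -
    have 1: "qpoch q (E*q) (Suc j) = qpoch q (E*q) j * (1 - E * q^Suc j)"
      "qpoch q (\<alpha>*q/F) (Suc j) = qpoch q (\<alpha>*q/F) j * (1 - \<alpha> * q^Suc j / F)"
      "qpoch q F (Suc j) = (1 - F) * qpoch q (F*q) j"
      "qpoch q (\<alpha>/E) (Suc j) = (1 - \<alpha>/E) * qpoch q (\<alpha>*q/E) j"
      using qpoch_Suc_left[of q F j] qpoch_Suc_left[of q "\<alpha>/E" j]
      by (simp_all add: qpoch_Suc mult_ac)
    show ?thesis
      unfolding tn1 1 DE R_def pw using \<alpha>E by (rule cancel1)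
  qed
  have tB: "N * t n (Suc j) * (1 - \<alpha>/F) = (M (Suc j) / (1-\<alpha>) * R j) *
      (q^Suc j * (1 - \<alpha> * (q^Suc j)^2) * ((1-E) * N * (1 - F * q^Suc j)) / (1 - \<alpha> * q^Suc j / E))"
    if "j < n" for j
  proof -
    have 1: "qpoch q (F*q) (Suc j) = qpoch q (F*q) j * (1 - F * q^Suc j)"
      "qpoch q (\<alpha>*q/E) (Suc j) = qpoch q (\<alpha>*q/E) j * (1 - \<alpha> * q^Suc j / E)"
      "qpoch q E (Suc j) = (1 - E) * qpoch q (E*q) j"
      "qpoch q (\<alpha>/F) (Suc j) = (1 - \<alpha>/F) * qpoch q (\<alpha>*q/F) j"
      using qpoch_Suc_left[of q E j] qpoch_Suc_left[of q "\<alpha>/F" j]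
      by (simp_all add: qpoch_Suc mult_ac)
    show ?thesis
      unfolding tn 1 R_def pw using \<alpha>F by (rule cancel2)
  qed
  \<comment> \<open>\<open>k = Suc n\<close> is kept out, since its denominator in \<open>t n\<close> may vanish.\<close>
  have partial: "(\<Sum>k\<le>j. D * (1 - E/\<alpha>) * t (Suc n) k - N * t n k * (1 - \<alpha>/F)) = H j" if "j \<le> n" for j
    using that
  proof (induction j)
    case 0
    have "H 0 = g * (1-b)*(1-c)*(1-d)"
      using \<alpha>0 by (simp add: H_def M_def R_def)
    moreover have "t n 0 = 1" "t (Suc n) 0 = 1" using \<alpha>0 by (simp_all add: tn tn1 M_def)
    moreover have "D * (1 - E/\<alpha>) - N * (1 - \<alpha>/F) = g * (1-b)*(1-c)*(1-d)"
      unfolding D_def N_def g_def Feq using nz E0 by (simp add: divide_simps) algebra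
    ultimately show ?case by simp
  next
    case (Suc j)
    define K where "K = q ^ Suc j"
    define B where "B = M (Suc j) / (1-\<alpha>) * R j"
    have nE: "1 - \<alpha>*K/E \<noteq> 0" and nF: "1 - \<alpha>*K/F \<noteq> 0"
      using \<alpha>Ek[of "Suc j"] \<alpha>Fk[of "Suc j"] Suc.prems by (auto simp: K_def)
    have HS: "H (Suc j) = B * (g * ((1-\<alpha>*K)*((1-b*K)*(1-c*K)*(1-d*K))*(1-E*K)*(1-F*K)) /
         ((1-\<alpha>*K/E)*(1-\<alpha>*K/F)))"
    proof -
      have "R (Suc j) = R j * ((1-E*K)*(1-F*K)) / ((1-\<alpha>*K/E)*(1-\<alpha>*K/F))"
        by (simp add: R_def qpoch_Suc K_def mult_ac)
      then show ?thesis by (simp add: H_def B_def K_def mult_ac)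
    qed
    have "(\<Sum>k\<le>Suc j. D * (1 - E/\<alpha>) * t (Suc n) k - N * t n k * (1 - \<alpha>/F)) =
       H j + (D * (1 - E/\<alpha>) * t (Suc n) (Suc j) - N * t n (Suc j) * (1 - \<alpha>/F))"
      using Suc by simp
    also have "\<dots> = B * (g * ((1-K)*((1-\<alpha>*K/b)*(1-\<alpha>*K/c)*(1-\<alpha>*K/d))) +
        K*(1-\<alpha>*K^2)*(- (E/\<alpha>) * (1-F) * D * (1 - E*K)) / (1 - \<alpha>*K/F) -
        K*(1-\<alpha>*K^2)*((1-E) * N * (1 - F*K)) / (1 - \<alpha>*K/E))" (is "_ = B * ?X")
    proof -
      have j: "j \<le> n" "j < n" using Suc.prems by auto
      have "g * B * x + (B * y - B * z) = B * (g * x + y - z)" for x y z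
        by (simp add: algebra_simps)
      then show ?thesis
        unfolding HB[OF j(1)] t'B[OF j(1)] tB[OF j(2)] B_def[symmetric] K_def[symmetric] .
    qed
    also have "?X = (g * ((1-\<alpha>*K)*((1-b*K)*(1-c*K)*(1-d*K))*(1-E*K)*(1-F*K)) /
         ((1-\<alpha>*K/E)*(1-\<alpha>*K/F)))"
    proof -
      have "?X * ((1-\<alpha>*K/E)*(1-\<alpha>*K/F)) =
        g * ((1-K)*((1-\<alpha>*K/b)*(1-\<alpha>*K/c)*(1-\<alpha>*K/d))) * (1-\<alpha>*K/E)*(1-\<alpha>*K/F) +
        K*(1-\<alpha>*K^2)*(- (E/\<alpha>) * (1-F) * D * (1 - E*K)) * (1-\<alpha>*K/E) -
        K*(1-\<alpha>*K^2)*((1-E) * N * (1 - F*K)) * (1-\<alpha>*K/F)"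
      proof -
        have "(u + v / z - w / y) * (y * z) = u * y * z + v * y - w * z"
          if "y \<noteq> 0" "z \<noteq> 0" for u v w y z :: complex
          using that by (simp add: field_simps)
        from this[OF nE nF] show ?thesis .
      qed
      also have "\<dots> = g * ((1-\<alpha>*K)*((1-b*K)*(1-c*K)*(1-d*K))*(1-E*K)*(1-F*K))"
      proof -
        have "g * (q1 * q2) * y * z + k1 * k2 * X * y - k1 * k2 * Y * z = g * P"
          if "g * (P - q1 * q2 * y * z) = k1 * k2 * (X * y - Y * z)" for P q1 q2 y z k1 k2 X Y :: complex
          using that by (simp add: algebra_simps)
        from this[OF sixfold_identity[OF nz(2-5) E0(1) Feq, of K, folded D_def N_def g_def]] show ?thesis .
      qed
      finally show ?thesis using nE nF by (simp add: eq_divide_eq)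
    qed
    finally show ?case unfolding HS .
  qed
  have last: "H n + D * (1 - E/\<alpha>) * t (Suc n) (Suc n) = 0"
  proof -
    define K where "K = q ^ Suc n"
    have K0: "K \<noteq> 0" using nz by (simp add: K_def)
    have FK: "F = 1 / K" by (simp add: F_def K_def)
    have nF: "1 - \<alpha>*K*K \<noteq> 0"
      using \<alpha>Fk[of "Suc n"] by (simp add: K_def FK)
    have "H n + D * (1 - E/\<alpha>) * t (Suc n) (Suc n) = (M (Suc n) / (1-\<alpha>) * R n) *
      (g * ((1-K)*((1-\<alpha>*K/b)*(1-\<alpha>*K/c)*(1-\<alpha>*K/d))) +
        K * (1 - \<alpha> * K^2) * (- (E/\<alpha>) * (1-F) * D * (1 - E*K)) / (1 - \<alpha>*K/F))"
    proof -
      have "g * B * x + B * y = B * (g * x + y)" for x y B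
        by (simp add: algebra_simps)
      then show ?thesis unfolding HB[OF order_refl] t'B[OF order_refl] K_def[symmetric] .
    qed
    \<comment> \<open>At the top index \<open>F = 1 / K\<close>, so the denominator equals
      \<open>1 - \<alpha> * K^2\<close> and cancels; what is left is the negative of the part from
      \<open>H n\<close>.\<close>
    also have "K * (1 - \<alpha> * K^2) * (- (E/\<alpha>) * (1-F) * D * (1 - E*K)) / (1 - \<alpha>*K/F) =
        - (E/\<alpha>) * (1 - E*K) * (K * (1-F)) * D"
    proof -
      have "K * w * (x * f * D * y) / w = x * y * (K * f) * D" if "w \<noteq> 0" for w x f y :: complex
        using that by (simp add: mult_ac)
      moreover have "1 - \<alpha> * K / F = 1 - \<alpha> * K\<^sup>2" "1 - \<alpha> * K\<^sup>2 \<noteq> 0"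
        using nF by (simp_all add: FK power2_eq_square mult_ac)
      ultimately show ?thesis by metis
    qed
    also have "K * (1-F) = - (1 - K)" using K0 by (simp add: FK field_simps)
    also have "g * ((1-K)*((1-\<alpha>*K/b)*(1-\<alpha>*K/c)*(1-\<alpha>*K/d))) = (- (E/\<alpha>) * (1 - E*K)) * (1-K) * D"
      by (simp add: g_def D_def FK)
    finally show ?thesis
      by (simp only: mult_minus_left mult_minus_right minus_minus right_minus left_minus mult_zero_right)
  qed
  have tn0: "t n (Suc n) = 0"
    unfolding tn using nz by (simp add: qpoch_Suc F_def)
  have "D * (1 - E/\<alpha>) * S (Suc n) - N * S n * (1 - \<alpha>/F) =
     (\<Sum>k\<le>n. D * (1 - E/\<alpha>) * t (Suc n) k - N * t n k * (1 - \<alpha>/F)) + D * (1 - E/\<alpha>) * t (Suc n) (Suc n)"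
    unfolding S_def t_def
    by (simp only: sum_subtractf sum_distrib_left sum_distrib_right sum.atMost_Suc distrib_left) simp
  also have "\<dots> = 0" using partial[of n] last by simp
  finally have "D * (1 - E/\<alpha>) * S (Suc n) = N * S n * (1 - \<alpha>/F)" by simp
  moreover have "E * b / \<alpha> = \<alpha> * q ^ Suc n / (c * d)" "E * c / \<alpha> = \<alpha> * q ^ Suc n / (b * d)"
    "E * d / \<alpha> = \<alpha> * q ^ Suc n / (b * c)" "E / \<alpha> = \<alpha> * q ^ Suc n / (b * c * d)"
    using nz by (simp_all add: E_def l field_simps power2_eq_square)
  ultimately show ?thesis
    by (simp add: D_def N_def F_def mult_ac)
qed

text \<open>Induction on \<open>n\<close> by \<open>jackson_step\<close>: with \<open>b\<close>,
  \<open>c\<close>, \<open>d\<close> fixed, balancing gives \<open>e = l * q ^ n\<close> with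
  \<open>l\<close> free of \<open>n\<close>. In the form without quotients, the step just multiplies
  both sides by further factors.\<close>

lemma jackson_sum:
  fixes q \<alpha> b c d e :: complex and n :: nat
  assumes nz: "q \<noteq> 0" "\<alpha> \<noteq> 0" "b \<noteq> 0" "c \<noteq> 0" "d \<noteq> 0" and e: "b * c * d * e = \<alpha>^2 * q ^ Suc n"
    and q1: "qpoch q q n \<noteq> 0"
    and \<alpha>1: "\<And>k. k \<le> 2 * n \<Longrightarrow> \<alpha> * q ^ k \<noteq> 1"
    and den: "qpoch q (\<alpha> * q / b) n \<noteq> 0" "qpoch q (\<alpha> * q / c) n \<noteq> 0"
      "qpoch q (\<alpha> * q / d) n \<noteq> 0" "qpoch q (\<alpha> * q / e) n \<noteq> 0"
  shows "(\<Sum>k\<le>n. vwp q \<alpha> [b, c, d, e, 1 / q ^ n] k) *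
      qpochs q [\<alpha> * q / b, \<alpha> * q / c, \<alpha> * q / d, \<alpha> * q / (b * c * d)] n =
    qpochs q [\<alpha> * q, \<alpha> * q / (b * c), \<alpha> * q / (b * d), \<alpha> * q / (c * d)] n"
proof -
  define l where "l = \<alpha>^2 * q / (b * c * d)"
  have el: "e = l * q ^ n" using nz e by (simp add: l_def field_simps)
  show ?thesis
    using q1 \<alpha>1 den unfolding el
  proof (induction n)
    case 0
    then show ?case by (simp add: vwp_def qpochs_def)
  next
    case (Suc n)
    \<comment> \<open>Since \<open>e\<close> moves with \<open>n\<close>, the condition for
      \<open>Suc n\<close> passes to \<open>n\<close> by dropping its first factor instead of its
      last.\<close>
    have sh: "qpoch q (\<alpha> * q / (l * q ^ n)) n \<noteq> 0"
      using Suc.prems(6) qpoch_Suc_left[of q "\<alpha> / (l * q ^ n)" n] nz by (auto simp: mult_ac)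
    note IH = Suc.IH[OF qpoch_mono_nz[OF Suc.prems(1)] Suc.prems(2) qpoch_mono_nz[OF Suc.prems(3)]
        qpoch_mono_nz[OF Suc.prems(4)] qpoch_mono_nz[OF Suc.prems(5)] sh]
    have IH': "(\<Sum>k\<le>n. vwp q \<alpha> [b, c, d, l * q ^ n, 1 / q ^ n] k) *
      qpochs q [\<alpha> * q / b, \<alpha> * q / c, \<alpha> * q / d, \<alpha> * q / (b * c * d)] n =
      qpochs q [\<alpha> * q, \<alpha> * q / (b * c), \<alpha> * q / (b * d), \<alpha> * q / (c * d)] n"
      by (rule IH) auto
    define X where "X = qpochs q [\<alpha> * q / b, \<alpha> * q / c, \<alpha> * q / d, \<alpha> * q / (b * c * d)] n"
    note step = jackson_step[OF nz l_def Suc.prems, THEN arg_cong[of _ _ "\<lambda>z. X * z"]]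
    have "(\<Sum>k\<le>Suc n. vwp q \<alpha> [b, c, d, l * q ^ Suc n, 1 / q ^ Suc n] k) *
      qpochs q [\<alpha> * q / b, \<alpha> * q / c, \<alpha> * q / d, \<alpha> * q / (b * c * d)] (Suc n) =
      X * ((1 - \<alpha> * q ^ Suc n / b) * (1 - \<alpha> * q ^ Suc n / c) * (1 - \<alpha> * q ^ Suc n / d) *
      (1 - \<alpha> * q ^ Suc n / (b * c * d)) * (\<Sum>k\<le>Suc n. vwp q \<alpha> [b, c, d, l * q ^ Suc n, 1 / q ^ Suc n] k))"
      by (simp add: X_def qpochs_Cons qpoch_Suc mult_ac del: sum.atMost_Suc)
    also have "\<dots> = X * ((1 - \<alpha> * q ^ Suc n) * (1 - \<alpha> * q ^ Suc n / (b * c)) * (1 - \<alpha> * q ^ Suc n / (b * d)) *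
      (1 - \<alpha> * q ^ Suc n / (c * d)) * (\<Sum>k\<le>n. vwp q \<alpha> [b, c, d, l * q ^ n, 1 / q ^ n] k))"
      by (rule step) assumption
    also have "\<dots> = ((\<Sum>k\<le>n. vwp q \<alpha> [b, c, d, l * q ^ n, 1 / q ^ n] k) * X) *
      ((1 - \<alpha> * q ^ Suc n) * (1 - \<alpha> * q ^ Suc n / (b * c)) * (1 - \<alpha> * q ^ Suc n / (b * d)) *
      (1 - \<alpha> * q ^ Suc n / (c * d)))"
      by (simp only: mult_ac)
    also have "\<dots> = qpochs q [\<alpha> * q, \<alpha> * q / (b * c), \<alpha> * q / (b * d), \<alpha> * q / (c * d)] (Suc n)"
      unfolding X_def IH' by (simp add: qpochs_Cons qpoch_Suc mult_ac)
    finally show ?case .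
  qed
qed

section \<open>Reflection and index shifts\<close>

text \<open>This is q to the power n(n-1)/2, without halving in the exponent.\<close>

definition qtri :: "complex \<Rightarrow> nat \<Rightarrow> complex" where
  "qtri q n = (\<Prod>l<n. q ^ l)"

lemma qtri_0 [simp]: "qtri q 0 = 1"
  by (simp add: qtri_def)

lemma qtri_Suc: "qtri q (Suc n) = qtri q n * q ^ n"
  by (simp add: qtri_def)

lemma qtri_nz: "q \<noteq> 0 \<Longrightarrow> qtri q n \<noteq> 0"
  by (simp add: qtri_def)

lemma qtri_square: "qtri q n * qtri q n * q ^ n = q ^ (n * n)"
  by (induction n) (simp_all add: qtri_Suc power_add algebra_simps)

text \<open>Reversal of the factors: \<open>x * q ^ l\<close> and \<open>y * q ^ (n - 1 - l)\<close>
  have product 1, so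
  \<open>1 - x * q ^ l = (1 - y * q ^ (n - 1 - l)) * (- x * q ^ l)\<close>.\<close>

lemma qpoch_reflect:
  assumes "x * y * q ^ n = q" "q \<noteq> 0"
  shows "qpoch q x n = qpoch q y n * ((- x) ^ n * qtri q n)"
  using assms(1)
proof (induction n arbitrary: y)
  case 0
  then show ?case by simp
next
  case (Suc n)
  have xy: "x * y * q ^ n = 1" using Suc.prems assms(2) by (simp add: mult_ac)
  then have IH: "qpoch q x n = qpoch q (y * q) n * ((- x) ^ n * qtri q n)"
    by (intro Suc.IH) (simp add: mult_ac)
  have "1 - x * q ^ n = (1 - y) * (- x * q ^ n)"
    using xy by (simp add: algebra_simps)
  then show ?case
    by (simp add: qpoch_Suc IH) (simp add: qpoch_Suc_left[of q y n, unfolded qpoch_Suc] qtri_Suc)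
qed

text \<open>Both sides are \<open>qpoch q p (i + k)\<close>, split at \<open>i\<close> and at
  \<open>k\<close>.\<close>

lemma qpoch_shift_up: "qpoch q (p * q ^ i) k * qpoch q p i = qpoch q p k * qpoch q (p * q ^ k) i"
  using qpoch_add[of q p i k] qpoch_add[of q p k i] by (simp add: add.commute mult.commute)

text \<open>The product \<open>qpoch q z (i + k)\<close> is split at \<open>i\<close> and at
  \<open>k\<close>, and the two blocks of length \<open>i\<close> are reflected;
  \<open>q ^ (k * i)\<close> is the quotient of the reflection factors.\<close>

lemma qpoch_shift_down:
  assumes "q \<noteq> 0" "z \<noteq> 0" "x = z * q ^ i"
  shows "qpoch q x k * qpoch q (q / x) i = q ^ (k * i) * qpoch q z k * qpoch q (q / (x * q ^ k)) i"
proof -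
  have x0: "x \<noteq> 0" using assms by simp
  have 1: "qpoch q z i = qpoch q (q / x) i * ((- z) ^ i * qtri q i)"
    using x0 assms(1) by (intro qpoch_reflect) (simp_all add: assms(3))
  have 2: "qpoch q (z * q ^ k) i = qpoch q (q / (x * q ^ k)) i * ((- (z * q ^ k)) ^ i * qtri q i)"
    using x0 assms(1) by (intro qpoch_reflect) (simp_all add: assms(3))
  have "qpoch q z i * qpoch q x k = qpoch q z k * qpoch q (z * q ^ k) i"
    using qpoch_add[of q z i k] qpoch_add[of q z k i] by (simp add: add.commute assms(3))
  then have "((- z) ^ i * qtri q i) * (qpoch q x k * qpoch q (q / x) i) =
      ((- z) ^ i * qtri q i) * (q ^ (k * i) * qpoch q z k * qpoch q (q / (x * q ^ k)) i)"
    unfolding 1 2 power_mult[of q k i]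
    by (simp add: power_mult_distrib power_minus[of "_ * _"] power_minus[of z] mult_ac)
  then show ?thesis using assms qtri_nz[of q i] by simp
qed

text \<open>Dividing by the denominator of \<open>phi\<close> or \<open>chi\<close> moves the weight
  parameter \<open>A / c\<close> to \<open>A / (c * q ^ i)\<close>, up to \<open>q ^ (k * i)\<close>
  and a factor free of \<open>k\<close>.\<close>

lemma qpoch_shift_quotient:
  fixes A c :: complex
  assumes nz: "q \<noteq> 0" "A \<noteq> 0" "c \<noteq> 0"
    and 1: "qpoch q (c * q) i \<noteq> 0" "qpoch q (c * q / A) i \<noteq> 0" "qpoch q (c * q / (A * q ^ k)) i \<noteq> 0"
      "qpoch q (c * q) (i + k) \<noteq> 0"
  shows "qpoch q (A / c) k / qpoch q (c * q) k /
      (qpoch q (c * q * q ^ k) i * qpoch q (c * q / (A * q ^ k)) i) =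
    q ^ (k * i) / (qpoch q (c * q) i * qpoch q (c * q / A) i) *
      (qpoch q (A / (c * q ^ i)) k / qpoch q (c * q * q ^ i) k)"
proof -
  have d: "qpoch q (A / c) k * qpoch q (c * q / A) i =
      q ^ (k * i) * qpoch q (A / (c * q ^ i)) k * qpoch q (c * q / (A * q ^ k)) i"
    using qpoch_shift_down[of q "A / (c * q ^ i)" "A / c" i k] nz by (simp add: mult_ac)
  have u: "qpoch q (c * q) k * qpoch q (c * q * q ^ k) i = qpoch q (c * q) i * qpoch q (c * q * q ^ i) k"
    using qpoch_add[of q "c * q" k i] qpoch_add[of q "c * q" i k] by (simp add: add.commute)
  have nz': "qpoch q (c * q) k \<noteq> 0" "qpoch q (c * q * q ^ k) i \<noteq> 0" "qpoch q (c * q * q ^ i) k \<noteq> 0"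
    using 1(4) u qpoch_add[of q "c * q" i k] by auto
  have gen: "x / w / (w' * z) = Q / (v * v') * (x' / s)"
    if "x * v' = Q * x' * z" "w * w' = v * s" "v' \<noteq> 0" "w \<noteq> 0" "w' \<noteq> 0" "z \<noteq> 0" "v \<noteq> 0" "s \<noteq> 0"
    for x w w' z Q v v' x' s :: complex
  proof -
    have "x / w / (w' * z) = (x * v') / (w * w' * z * v')" using that(3) by simp
    also have "\<dots> = Q * x' / (v * s * v')" unfolding that(1,2) using that(6) by simp
    finally show ?thesis by (simp add: mult_ac)
  qed
  show ?thesis using d u 1(2) nz'(1,2) 1(3) 1(1) nz'(3) by (rule gen)
qed

text \<open>The numerator of \<open>phi\<close> at \<open>k = j + l\<close> turns the base
  \<open>A\<close> into \<open>A * q ^ (2 * j)\<close>. The power \<open>q ^ ((j + l) * j)\<close>,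
  left over from \<open>qpoch_shift_quotient\<close>, is used up by the reflection of
  \<open>1 / q ^ (j + l)\<close>.\<close>

lemma vwp_base_shift:
  assumes q: "q \<noteq> 0" "1 - A \<noteq> 0" "1 - A * q ^ (2 * j) \<noteq> 0" and ql: "qpoch q q (j + l) \<noteq> 0"
  shows "vwp q A [] (j + l) * (q ^ ((j + l) * j) * (qpoch q (1 / q ^ (j + l)) j * qpoch q (A * q ^ (j + l)) j)) =
    (- 1) ^ j * qtri q j * q ^ j * (qpoch q A (2 * j) * (1 - A * q ^ (2 * j)) / (1 - A)) *
    vwp q (A * q ^ (2 * j)) [] l"
proof -
  have A: "qpoch q A (j + l) * qpoch q (A * q ^ (j + l)) j = qpoch q A (2 * j) * qpoch q (A * q ^ (2 * j)) l"
  proof -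
    have "j + l + j = 2 * j + l" by simp
    then show ?thesis
      using qpoch_add[of q A "j + l" j] qpoch_add[of q A "2 * j" l] by metis
  qed
  have B: "qpoch q (1 / q ^ (j + l)) j * q ^ ((j + l) * j) = qpoch q (q ^ Suc l) j * ((- 1) ^ j * qtri q j)"
  proof -
    have "qpoch q (1 / q ^ (j + l)) j = qpoch q (q ^ Suc l) j * ((- (1 / q ^ (j + l))) ^ j * qtri q j)"
      using q by (intro qpoch_reflect) (simp_all add: power_add field_simps)
    moreover have "(- (1 / q ^ (j + l))) ^ j * q ^ ((j + l) * j) = (- 1) ^ j"
      unfolding power_mult power_mult_distrib[symmetric] using q by simp
    ultimately show ?thesis by (simp add: mult_ac)
  qed
  have C: "qpoch q q (j + l) = qpoch q q l * qpoch q (q ^ Suc l) j"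
    using qpoch_add[of q q l j] by (simp add: add.commute)
  then have C0: "qpoch q q l \<noteq> 0" "qpoch q (q ^ Suc l) j \<noteq> 0" using ql by auto
  have "vwp q A [] (j + l) * (q ^ ((j + l) * j) * (qpoch q (1 / q ^ (j + l)) j * qpoch q (A * q ^ (j + l)) j)) =
    (1 - A * q ^ (2 * (j + l))) / (1 - A) * ((qpoch q A (j + l) * qpoch q (A * q ^ (j + l)) j) *
      (qpoch q (1 / q ^ (j + l)) j * q ^ ((j + l) * j)) / qpoch q q (j + l)) * q ^ (j + l)"
    unfolding vwp_Nil by (simp add: mult_ac)
  also have "\<dots> = (1 - A * q ^ (2 * (j + l))) / (1 - A) * ((qpoch q A (2 * j) * qpoch q (A * q ^ (2 * j)) l) *
      ((- 1) ^ j * qtri q j) / qpoch q q l) * q ^ (j + l)"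
    unfolding A B C using C0 by simp
  also have "1 - A * q ^ (2 * (j + l)) = 1 - A * q ^ (2 * j) * q ^ (2 * l)"
    by (simp add: power_add add_mult_distrib2)
  finally show ?thesis unfolding vwp_Nil using q(3) by (simp add: power_add mult_ac)
qed

section \<open>The weight and its moments\<close>

text \<open>\<open>a'\<close>, \<open>d'\<close>, \<open>e'\<close> are parameters with defining
  equations, so that exchanging them with \<open>a\<close>, \<open>d\<close>, \<open>e\<close> gives
  another instance of the locale. The family of nonvanishing conditions is closed under this
  exchange.\<close>

locale wilson =
  fixes q A a d e a' d' e' f :: complex and N :: nat
  assumes q0: "q \<noteq> 0" and qpow: "\<And>k. 0 < k \<Longrightarrow> q ^ k \<noteq> 1"
    and nz: "A \<noteq> 0" "a \<noteq> 0" "d \<noteq> 0" "e \<noteq> 0"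
    and a': "a' = a * q / (d * e * q ^ N)" and d': "d' = q / (d * q ^ N)" and e': "e' = q / (e * q ^ N)"
    and f: "f = a\<^sup>2 * q / (A * d * e * q ^ N)"
    and A1: "\<And>k. k \<le> 2 * N \<Longrightarrow> A * q ^ k \<noteq> 1"
    and a1: "\<And>k. k \<le> 2 * N \<Longrightarrow> a * q ^ k \<noteq> 1"
    and a'1: "\<And>k. k \<le> 2 * N \<Longrightarrow> a' * q ^ k \<noteq> 1"
    and aA: "\<And>i j. i \<le> N \<Longrightarrow> j < N \<Longrightarrow> a * q ^ i \<noteq> A * q ^ j"
    and a'A: "\<And>i j. i \<le> N \<Longrightarrow> j < N \<Longrightarrow> a' * q ^ i \<noteq> A * q ^ j"
    and d1: "\<And>k. k < N \<Longrightarrow> d * q ^ k \<noteq> 1" and e1: "\<And>k. k < N \<Longrightarrow> e * q ^ k \<noteq> 1"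
    and Ad: "\<And>k. k < N \<Longrightarrow> A * d * q ^ k \<noteq> a" and Ae: "\<And>k. k < N \<Longrightarrow> A * e * q ^ k \<noteq> a"
    and ad: "\<And>k. k < N \<Longrightarrow> a * q ^ Suc k \<noteq> d" and ae: "\<And>k. k < N \<Longrightarrow> a * q ^ Suc k \<noteq> e"
    and f1: "\<And>k. k < N \<Longrightarrow> f * q ^ Suc k \<noteq> 1"
begin

lemma nz': "a' \<noteq> 0" "d' \<noteq> 0" "e' \<noteq> 0" "f \<noteq> 0"
  using nz q0 by (auto simp: a' d' e' f)

text \<open>Since \<open>a' / d' = a / e\<close> and \<open>a' / e' = a / d\<close>, the conditions
  \<open>Ad\<close> and \<open>Ae\<close> trade places, and so do \<open>ad\<close> and
  \<open>ae\<close>.\<close>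

lemma dual: "wilson q A a' d' e' a d e f N"
proof
  show "a = a' * q / (d' * e' * q ^ N)" "d = q / (d' * q ^ N)" "e = q / (e' * q ^ N)"
    "f = a'\<^sup>2 * q / (A * d' * e' * q ^ N)"
    using nz q0 by (simp_all add: a' d' e' f power2_eq_square field_simps)
  \<comment> \<open>As \<open>x * y * q ^ N = q\<close>, a vanishing factor for \<open>x\<close> at
    \<open>k\<close> means one for \<open>y\<close> at \<open>N - 1 - k\<close>.\<close>
  have sw: "x * q ^ k \<noteq> 1" if "\<And>k. k < N \<Longrightarrow> y * q ^ k \<noteq> 1" "x = q / (y * q ^ N)" "k < N" "y \<noteq> 0"
    for x y k
  proof
    assume "x * q ^ k = 1"
    moreover have "q ^ N = q * q ^ k * q ^ (N - Suc k)"
      using that(3) by (metis Suc_le_eq le_add_diff_inverse power_Suc power_add)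
    ultimately have "y * q ^ (N - Suc k) = 1"
      using q0 that(2,4) by (simp add: field_simps)
    then show False using that(1)[of "N - Suc k"] that(3) by simp
  qed
  show "d' * q ^ k \<noteq> 1" if "k < N" for k using sw[OF d1 d' that nz(3)] .
  show "e' * q ^ k \<noteq> 1" if "k < N" for k using sw[OF e1 e' that nz(4)] .
  show "A * d' * q ^ k \<noteq> a'" if "k < N" for k
    using Ae[OF that] nz q0 by (auto simp: a' d' field_simps)
  show "A * e' * q ^ k \<noteq> a'" if "k < N" for k
    using Ad[OF that] nz q0 by (auto simp: a' e' field_simps)
  show "a' * q ^ Suc k \<noteq> d'" if "k < N" for k
    using ae[OF that] nz q0 by (auto simp: a' d' field_simps)
  show "a' * q ^ Suc k \<noteq> e'" if "k < N" for k
    using ad[OF that] nz q0 by (auto simp: a' e' field_simps)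
qed (use q0 qpow nz nz' A1 a1 a'1 aA a'A f1 in auto)

abbreviation P :: "complex \<Rightarrow> nat \<Rightarrow> complex" where "P \<equiv> qpoch q"

text \<open>The \<open>k\<close>-dependent part of \<open>r\<close>, as a very-well-poised term with
  base \<open>A\<close>; the remaining constant is \<open>weight_norm\<close>.\<close>

definition weight :: "nat \<Rightarrow> complex" where
  "weight k = vwp q A [a * q / d, a * q / e, 1 / q ^ N, A / a, A / a'] k"

definition phi :: "complex \<Rightarrow> nat \<Rightarrow> nat \<Rightarrow> complex" where
  "phi c i k = P (1 / q ^ k) i * P (A * q ^ k) i / (P (c * q * q ^ k) i * P (c * q / (A * q ^ k)) i)"

definition chi :: "nat \<Rightarrow> nat \<Rightarrow> complex" where
  "chi i k = P (q ^ k / q ^ N) i * P (1 / (A * q ^ N * q ^ k)) i /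
    (P (a * q * q ^ k) i * P (a * q / (A * q ^ k)) i)"

definition chi_const :: "nat \<Rightarrow> complex" where
  "chi_const i = P (1 / q ^ N) i * P (1 / (A * q ^ N)) i / (P (a * q) i * P (a * q / A) i)"

text \<open>The factor free of \<open>l\<close> that comes out of the product of
  \<open>weight\<close>, \<open>chi\<close> and \<open>phi\<close> at \<open>k = j + l\<close> in
  \<open>term_product\<close>.\<close>

definition moment_const :: "nat \<Rightarrow> nat \<Rightarrow> complex" where
  "moment_const i j = chi_const i / (P (a' * q) j * P (a' * q / A) j) *
    ((- 1) ^ j * qtri q j * q ^ j * (P A (2 * j) * (1 - A * q ^ (2 * j)) / (1 - A))) *
    (P (a * q / d) j / P (A * d / a) j) * (P (a * q / e) j / P (A * e / a) j) *
    (P (A / (a' * q ^ j)) j / P (a' * q * q ^ j) j) *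
    (P (A / (a * q ^ i)) j / P (a * q * q ^ i) j) *
    (P (q ^ i / q ^ N) j / P (A * q * q ^ N / q ^ i) j)"

lemma P_q: "P q n \<noteq> 0"
  using qpow[of "Suc _"] by (auto simp: qpoch_nz_iff)

lemma P_A: "0 < s \<Longrightarrow> s + n \<le> 2 * N + 1 \<Longrightarrow> P (A * q ^ s) n \<noteq> 0"
  unfolding qpoch_nz_iff mult.assoc power_add[symmetric] using A1 by auto

lemma P_a: "s + n \<le> 2 * N + 1 \<Longrightarrow> P (a * q ^ s) n \<noteq> 0"
  unfolding qpoch_nz_iff mult.assoc power_add[symmetric] using a1 by auto

lemma P_aA: assumes "s + n \<le> Suc N" "k \<le> N" "0 < s" shows "P (a * q ^ s / (A * q ^ k)) n \<noteq> 0"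
proof -
  \<comment> \<open>\<open>aA\<close> bounds the exponent next to \<open>A\<close> strictly by
    \<open>N\<close>; for \<open>k > 0\<close> one power of \<open>q\<close> is cancelled first,
    which \<open>0 < s\<close> permits.\<close>
  have "a * q ^ (s + l) \<noteq> A * q ^ k" if "l < n" for l
  proof (cases k)
    case 0
    then show ?thesis using aA[of "s + l" 0] that assms by auto
  next
    case (Suc k')
    then show ?thesis using aA[of "s + l - 1" k'] that assms q0 by (cases s) auto
  qed
  then show ?thesis unfolding qpoch_nz_iff using nz q0 by (simp add: power_add field_simps)
qed

lemma P_a': "s + n \<le> 2 * N + 1 \<Longrightarrow> P (a' * q ^ s) n \<noteq> 0"
  using wilson.P_a[OF dual] .

lemma P_a'A: "s + n \<le> Suc N \<Longrightarrow> k \<le> N \<Longrightarrow> 0 < s \<Longrightarrow> P (a' * q ^ s / (A * q ^ k)) n \<noteq> 0"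
  using wilson.P_aA[OF dual] .

text \<open>The denominators of \<open>chi\<close> and \<open>phi\<close> shift \<open>A / a\<close>
  and \<open>A / a'\<close> (\<open>p1\<close>, \<open>p2\<close>), the numerator of
  \<open>chi\<close> shifts \<open>1 / q ^ N\<close> (\<open>p3\<close>), and that of
  \<open>phi\<close> shifts the base (\<open>p4\<close>). The powers of \<open>q\<close> created by
  \<open>p1\<close> and \<open>p2\<close> are consumed by \<open>p3\<close> and
  \<open>p4\<close>.\<close>

lemma term_product:
  assumes "i + j + l \<le> N"
  shows "weight (j + l) * chi i (j + l) * phi a' j (j + l) = moment_const i j *
    vwp q (A * q ^ (2 * j)) [a * q * q ^ j / d, a * q * q ^ j / e, A / a', A * q ^ j / (a * q ^ i),
      1 / q ^ (N - i - j)] l"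
proof -
  define k where "k = j + l"
  have k: "k + i \<le> N" "j \<le> k" using assms by (auto simp: k_def)
  have p1: "P (A / a) k / P (a * q) k / (P (a * q * q ^ k) i * P (a * q / (A * q ^ k)) i) =
    q ^ (k * i) / (P (a * q) i * P (a * q / A) i) * (P (A / (a * q ^ i)) k / P (a * q * q ^ i) k)"
    using k P_a[of 1 i] P_a[of 1 "i + k"] P_aA[of 1 i k] P_aA[of 1 i 0]
    by (intro qpoch_shift_quotient q0 nz) auto
  have p2: "P (A / a') k / P (a' * q) k / (P (a' * q * q ^ k) j * P (a' * q / (A * q ^ k)) j) =
    q ^ (k * j) / (P (a' * q) j * P (a' * q / A) j) * (P (A / (a' * q ^ j)) k / P (a' * q * q ^ j) k)"
    using k P_a'[of 1 j] P_a'[of 1 "j + k"] P_a'A[of 1 j k] P_a'A[of 1 j 0]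
    by (intro qpoch_shift_quotient q0 nz nz') auto
  have qN: "q ^ N = q ^ i * q ^ (N - i)" using k by (simp flip: power_add)
  have Aq: "A * q * q ^ N / q ^ i = A * q ^ Suc (N - i)" using q0 by (simp add: qN)
  have p3: "q ^ (k * i) * (P (1 / q ^ N) k / P (A * q * q ^ N) k) * (P (q ^ k / q ^ N) i * P (1 / (A * q ^ N * q ^ k)) i) =
      P (1 / q ^ N) i * P (1 / (A * q ^ N)) i * (P (q ^ i / q ^ N) k / P (A * q * q ^ N / q ^ i) k)"
  proof -
    have 1: "P (q ^ i / q ^ N) k * P (1 / q ^ N) i = P (1 / q ^ N) k * P (q ^ k / q ^ N) i"
      using qpoch_shift_up[of q "1 / q ^ N" i k] by simp
    have 2: "P (A * q * q ^ N) k * P (1 / (A * q ^ N)) i =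
        q ^ (k * i) * P (A * q * q ^ N / q ^ i) k * P (1 / (A * q ^ N * q ^ k)) i"
      using qpoch_shift_down[of q "A * q * q ^ N / q ^ i" "A * q * q ^ N" i k] q0 nz by (simp add: mult_ac)
    have 3: "P (A * q * q ^ N) k \<noteq> 0" "P (A * q * q ^ N / q ^ i) k \<noteq> 0"
      using P_A[of "Suc N" k] P_A[of "Suc (N - i)" k] k unfolding Aq by (auto simp: mult_ac)
    have gen: "Q * (x / y) * (u * v) = x' * y' * (z / t)"
      if "z * x' = x * u" "y * y' = Q * t * v" "y \<noteq> 0" "t \<noteq> 0" for Q x y u v x' y' z t :: complex
    proof -
      have "Q * (x / y) * (u * v) = (x * u) * (Q * t * v) / (y * t)" using that(4) by (simp add: mult_ac)
      also have "\<dots> = (z * x') * (y * y') / (y * t)" unfolding that(1,2) ..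
      finally show ?thesis using that(3) by (simp add: mult_ac)
    qed
    show ?thesis by (rule gen[OF 1 2 3])
  qed
  have p4: "vwp q A [] k * (q ^ (k * j) * (P (1 / q ^ k) j * P (A * q ^ k) j)) =
    (- 1) ^ j * qtri q j * q ^ j * (P A (2 * j) * (1 - A * q ^ (2 * j)) / (1 - A)) *
    vwp q (A * q ^ (2 * j)) [] l"
    unfolding k_def using A1[of 0] A1[of "2 * j"] k P_q q0 by (intro vwp_base_shift) auto
  have split: "P x k / P y k = (P x j / P y j) * (P (x * q ^ j) l / P (y * q ^ j) l)" for x y
    by (simp add: k_def qpoch_add)
  have "weight k * chi i k * phi a' j k =
    (vwp q A [] k * (P (1 / q ^ k) j * P (A * q ^ k) j)) * (P (a * q / d) k / P (A * d / a) k) *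
    (P (a * q / e) k / P (A * e / a) k) *
    ((P (1 / q ^ N) k / P (A * q * q ^ N) k) * (P (q ^ k / q ^ N) i * P (1 / (A * q ^ N * q ^ k)) i)) *
    (P (A / a) k / P (a * q) k / (P (a * q * q ^ k) i * P (a * q / (A * q ^ k)) i)) *
    (P (A / a') k / P (a' * q) k / (P (a' * q * q ^ k) j * P (a' * q / (A * q ^ k)) j))"
    unfolding weight_def chi_def phi_def vwp_Cons using q0 nz nz' by (simp add: mult_ac)
  also have "\<dots> = (vwp q A [] k * (q ^ (k * j) * (P (1 / q ^ k) j * P (A * q ^ k) j))) *
    (P (a * q / d) k / P (A * d / a) k) * (P (a * q / e) k / P (A * e / a) k) *
    (q ^ (k * i) * (P (1 / q ^ N) k / P (A * q * q ^ N) k) * (P (q ^ k / q ^ N) i * P (1 / (A * q ^ N * q ^ k)) i)) *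
    (1 / (P (a * q) i * P (a * q / A) i) * (P (A / (a * q ^ i)) k / P (a * q * q ^ i) k)) *
    (1 / (P (a' * q) j * P (a' * q / A) j) * (P (A / (a' * q ^ j)) k / P (a' * q * q ^ j) k))"
    unfolding p1 p2 by (simp add: mult_ac)
  also have "\<dots> = moment_const i j * (vwp q (A * q ^ (2 * j)) [] l *
      (P (a * q / d * q ^ j) l / P (A * d / a * q ^ j) l) * (P (a * q / e * q ^ j) l / P (A * e / a * q ^ j) l) *
      (P (q ^ i / q ^ N * q ^ j) l / P (A * q * q ^ N / q ^ i * q ^ j) l) *
      (P (A / (a * q ^ i) * q ^ j) l / P (a * q * q ^ i * q ^ j) l) *
      (P (A / (a' * q ^ j) * q ^ j) l / P (a' * q * q ^ j * q ^ j) l))"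
    unfolding p3 p4 unfolding split moment_const_def chi_const_def by (simp add: mult_ac)
  also have "vwp q (A * q ^ (2 * j)) [] l *
      (P (a * q / d * q ^ j) l / P (A * d / a * q ^ j) l) * (P (a * q / e * q ^ j) l / P (A * e / a * q ^ j) l) *
      (P (q ^ i / q ^ N * q ^ j) l / P (A * q * q ^ N / q ^ i * q ^ j) l) *
      (P (A / (a * q ^ i) * q ^ j) l / P (a * q * q ^ i * q ^ j) l) *
      (P (A / (a' * q ^ j) * q ^ j) l / P (a' * q * q ^ j * q ^ j) l) =
    vwp q (A * q ^ (2 * j)) [a * q * q ^ j / d, a * q * q ^ j / e, A / a', A * q ^ j / (a * q ^ i),
      1 / q ^ (N - i - j)] l"
  proof -
    have j2: "q ^ (2 * j) = q ^ j * q ^ j" by (simp add: mult_2 power_add)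
    have qN': "q ^ N = q ^ i * q ^ j * q ^ (N - i - j)" using assms by (simp flip: power_add)
    have 1: "a * q / d * q ^ j = a * q * q ^ j / d" "a * q / e * q ^ j = a * q * q ^ j / e"
      "q ^ i / q ^ N * q ^ j = 1 / q ^ (N - i - j)" "A / (a * q ^ i) * q ^ j = A * q ^ j / (a * q ^ i)"
      "A / (a' * q ^ j) * q ^ j = A / a'"
      unfolding qN' using q0 by simp_all
    have 2: "A * q ^ (2 * j) * q / (a * q * q ^ j / d) = A * d / a * q ^ j"
      "A * q ^ (2 * j) * q / (a * q * q ^ j / e) = A * e / a * q ^ j"
      "A * q ^ (2 * j) * q / (1 / q ^ (N - i - j)) = A * q * q ^ N / q ^ i * q ^ j"
      "A * q ^ (2 * j) * q / (A * q ^ j / (a * q ^ i)) = a * q * q ^ i * q ^ j"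
      "A * q ^ (2 * j) * q / (A / a') = a' * q * q ^ j * q ^ j"
      unfolding j2 qN' using q0 nz nz' by (simp_all add: mult_ac)
    show ?thesis unfolding vwp_Cons 2 1 by (simp add: mult_ac)
  qed
  finally show ?thesis by (simp add: k_def)
qed

section \<open>Closed form of the moments\<close>

text \<open>The reflection partner of \<open>f * q\<close>:
  \<open>eta * (f * q) * q ^ N = q\<close>.\<close>

definition eta :: complex where "eta = A * d * e / (a\<^sup>2 * q)"

text \<open>The moment for \<open>j = 0\<close>, that is, the sum of
  \<open>weight k * chi i k\<close>; \<open>moment_ratio i j\<close> is the factor by which
  \<open>phi a' j\<close> changes it.\<close>

definition chi_moment :: "nat \<Rightarrow> complex" where
  "chi_moment i = chi_const i * (P (A * q) (N - i) * P eta (N - i) * P d' (N - i) * P e' (N - i)) /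
     (P (A * d / a) (N - i) * P (A * e / a) (N - i) * P (a' * q) (N - i) * P (1 / (a * q ^ N)) (N - i))"

definition moment_ratio :: "nat \<Rightarrow> nat \<Rightarrow> complex" where
  "moment_ratio i j = P (A / (a * q ^ i)) j * P (a * q / d) j * P (a * q / e) j * P (q ^ i / q ^ N) j /
     (P (f * q * q ^ i) j * P (a' * q * q ^ (N - i)) j * P d' j * P e' j)"

lemma P_Ad: "s + n \<le> N \<Longrightarrow> P (A * d * q ^ s / a) n \<noteq> 0"
  unfolding qpoch_nz_iff using Ad nz by (auto simp: field_simps simp flip: power_add)

lemma P_Ae: "s + n \<le> N \<Longrightarrow> P (A * e * q ^ s / a) n \<noteq> 0"
  unfolding qpoch_nz_iff using Ae nz by (auto simp: field_simps simp flip: power_add)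

lemma P_ad: "n \<le> N \<Longrightarrow> P (a * q / d) n \<noteq> 0"
  unfolding qpoch_nz_iff using ad nz by (auto simp: field_simps)

lemma P_ae: "n \<le> N \<Longrightarrow> P (a * q / e) n \<noteq> 0"
  unfolding qpoch_nz_iff using ae nz by (auto simp: field_simps)

lemma P_d: "n \<le> N \<Longrightarrow> P d n \<noteq> 0"
  unfolding qpoch_nz_iff using d1 by auto

lemma P_e: "n \<le> N \<Longrightarrow> P e n \<noteq> 0"
  unfolding qpoch_nz_iff using e1 by auto

lemma P_f: "s + n \<le> N \<Longrightarrow> P (f * q * q ^ s) n \<noteq> 0"
  unfolding qpoch_nz_iff using f1[of "s + _"] by (auto simp: power_add mult_ac)

lemmas P_d' = wilson.P_d[OF dual]
lemmas P_e' = wilson.P_e[OF dual]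

lemma P_qN: assumes "n \<le> N - s" shows "P (q ^ s / q ^ N) n \<noteq> 0"
  unfolding qpoch_nz_iff
proof (intro allI impI notI)
  fix l assume l: "l < n" and "q ^ s / q ^ N * q ^ l = 1"
  then have "q ^ (s + l) = q ^ N" using q0 by (simp add: power_add field_simps)
  moreover have "q ^ N = q ^ (s + l) * q ^ (N - s - l)"
    using l assms by (simp flip: power_add)
  ultimately have "q ^ (N - s - l) = 1" using q0 by simp
  then show False using qpow[of "N - s - l"] l assms less_diff_conv[of l N s] by simp
qed

lemma q_double: "q ^ (2 * j) = q ^ j * q ^ j"
  by (simp add: mult_2 power_add)

text \<open>Jackson's sum with base \<open>A * q ^ (2 * j)\<close> and length
  \<open>N - i - j\<close>; the value of \<open>a'\<close> makes the parameters balanced.\<close>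

lemma moment_jackson:
  assumes "i + j \<le> N"
  defines "M \<equiv> N - i - j"
  shows "(\<Sum>l\<le>M. vwp q (A * q ^ (2 * j)) [a * q * q ^ j / d, a * q * q ^ j / e, A / a',
       A * q ^ j / (a * q ^ i), 1 / q ^ M] l) *
     (P (A * d / a * q ^ j) M * P (A * e / a * q ^ j) M * P (a' * q * q ^ (2 * j)) M * P (1 / (a * q ^ N)) M) =
     P (A * q * q ^ (2 * j)) M * P eta M * P (e' * q ^ j) M * P (d' * q ^ j) M"
proof -
  have M: "q ^ N = q ^ i * q ^ j * q ^ M" using assms by (simp flip: power_add)
  have 1: "A * q ^ (2 * j) * q / (a * q * q ^ j / d) = A * d / a * q ^ j"
    "A * q ^ (2 * j) * q / (a * q * q ^ j / e) = A * e / a * q ^ j"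
    "A * q ^ (2 * j) * q / (A * q ^ j / (a * q ^ i)) = a * q ^ (Suc (i + j))"
    "A * q ^ (2 * j) * q / (A / a') = a' * q * q ^ (2 * j)"
    "A * q ^ (2 * j) * q / (a * q * q ^ j / d * (a * q * q ^ j / e)) = eta"
    "A * q ^ (2 * j) * q / (a * q * q ^ j / d * (a * q * q ^ j / e) * (A / a')) = 1 / (a * q ^ N)"
    "A * q ^ (2 * j) * q / (a * q * q ^ j / d * (A / a')) = e' * q ^ j"
    "A * q ^ (2 * j) * q / (a * q * q ^ j / e * (A / a')) = d' * q ^ j"
    "A * q ^ (2 * j) * q = A * q * q ^ (2 * j)"
    unfolding q_double using q0 nz by (simp_all add: a' e' d' eta_def power_add power2_eq_square field_simps)
  have bal: "(a * q * q ^ j / d) * (a * q * q ^ j / e) * (A / a') * (A * q ^ j / (a * q ^ i)) =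
      (A * q ^ (2 * j))\<^sup>2 * q ^ Suc M"
    unfolding q_double using q0 nz by (simp add: a' M power2_eq_square field_simps)
  have "A * q ^ (2 * j) * q ^ k \<noteq> 1" if "k \<le> 2 * M" for k
    using A1[of "2 * j + k"] that assms by (simp add: power_add mult_ac)
  moreover have "P (A * d / a * q ^ j) M \<noteq> 0" "P (A * e / a * q ^ j) M \<noteq> 0"
    using P_Ad[of j M] P_Ae[of j M] assms by auto
  moreover have "P (a' * q * q ^ (2 * j)) M \<noteq> 0" "P (a * q ^ (Suc (i + j))) M \<noteq> 0"
    using P_a'[of "Suc (2 * j)" M] P_a[of "Suc (i + j)" M] assms by (auto simp: mult_ac)
  ultimately have "(\<Sum>l\<le>M. vwp q (A * q ^ (2 * j)) [a * q * q ^ j / d, a * q * q ^ j / e, A / a',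
       A * q ^ j / (a * q ^ i), 1 / q ^ M] l) *
     qpochs q [A * d / a * q ^ j, A * e / a * q ^ j, a' * q * q ^ (2 * j), 1 / (a * q ^ N)] M =
     qpochs q [A * q ^ (2 * j) * q, eta, e' * q ^ j, d' * q ^ j] M"
    using q0 nz nz' P_q bal
    by (intro jackson_sum[of q "A * q ^ (2 * j)" "a * q * q ^ j / d" "a * q * q ^ j / e" "A / a'"
        "A * q ^ j / (a * q ^ i)" M, unfolded 1(1-8)]) auto
  then show ?thesis unfolding qpochs_Cons 1(9) by (simp add: mult.assoc)
qed

lemma P_inv_a: assumes "n \<le> N" shows "P (1 / (a * q ^ N)) n \<noteq> 0"
  unfolding qpoch_nz_iff
proof (intro allI impI notI)
  fix l assume l: "l < n" "1 / (a * q ^ N) * q ^ l = 1"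
  have N: "q ^ N = q ^ (N - l) * q ^ l" using l(1) assms by (simp flip: power_add)
  have "q ^ l = a * q ^ N" using l(2) q0 nz by (simp add: field_simps)
  then have "(a * q ^ (N - l) - 1) * q ^ l = 0" unfolding N by (simp only: left_diff_distrib mult.assoc) simp
  then have "a * q ^ (N - l) = 1" using q0 by simp
  then show False using a1[of "N - l"] by simp
qed

text \<open>Products of length \<open>N - i - j\<close> are completed to length
  \<open>N - i\<close>, which is free of \<open>j\<close>. Reflection (\<open>s5\<close>,
  \<open>s6\<close>, \<open>s7\<close>) gives the remaining factors a common shape, and its powers
  cancel by \<open>pw\<close>.\<close>

lemma moment_simplify:
  assumes ij: "i + j \<le> N"
  defines "M \<equiv> N - i - j"
  shows "moment_const i j * (P (A * q * q ^ (2 * j)) M * P eta M * P (e' * q ^ j) M * P (d' * q ^ j) M /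
      (P (A * d / a * q ^ j) M * P (A * e / a * q ^ j) M * P (a' * q * q ^ (2 * j)) M * P (1 / (a * q ^ N)) M))
    = chi_moment i * moment_ratio i j"
proof -
  have M0: "N - i = M + j" "N - i = j + M" using assms by auto
  have M: "q ^ N = q ^ i * q ^ j * q ^ M" using assms by (simp flip: power_add)
  have s1: "P A (2 * j) * (1 - A * q ^ (2 * j)) / (1 - A) * P (A * q * q ^ (2 * j)) M =
      P (A * q) (N - i) * P (A * q * q ^ N / q ^ i) j"
  proof -
    have "P A (2 * j) * (1 - A * q ^ (2 * j)) * P (A * q * q ^ (2 * j)) M = P A (Suc (2 * j) + M)"
      unfolding qpoch_add by (simp add: qpoch_Suc mult_ac)
    also have "Suc (2 * j) + M = Suc (N - i + j)" using M0 by simp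
    also have "P A \<dots> = (1 - A) * (P (A * q) (N - i) * P (A * q * q ^ (N - i)) j)"
      by (simp add: qpoch_Suc_left qpoch_add)
    also have "A * q * q ^ (N - i) = A * q * q ^ N / q ^ i"
      using q0 by (simp add: M M0 power_add)
    finally show ?thesis using A1[of 0] by (simp add: field_simps)
  qed
  have s2: "P (A * d / a) j * P (A * d / a * q ^ j) M = P (A * d / a) (N - i)"
    "P (A * e / a) j * P (A * e / a * q ^ j) M = P (A * e / a) (N - i)"
    "P d' j * P (d' * q ^ j) M = P d' (N - i)" "P e' j * P (e' * q ^ j) M = P e' (N - i)"
    unfolding M0(2) by (simp_all add: qpoch_add)
  have s3: "P (a' * q) j * P (a' * q * q ^ j) j * P (a' * q * q ^ (2 * j)) M =
      P (a' * q) (N - i) * P (a' * q * q ^ (N - i)) j"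
  proof -
    have "P (a' * q) (j + j + M) = P (a' * q) (N - i + j)" using M0 by (simp add: add_ac)
    then show ?thesis unfolding qpoch_add q_double by (simp add: power_add mult_ac)
  qed
  have s5: "P eta (N - i) = P eta M * (P (f * q * q ^ i) j * ((- (eta * q ^ M)) ^ j * qtri q j))"
    unfolding M0(1) qpoch_add
    using qpoch_reflect[of "eta * q ^ M" "f * q * q ^ i" q j] q0 nz
    by (simp add: eta_def f M power2_eq_square)
  have s6: "P (1 / (a * q ^ N)) (N - i) = P (1 / (a * q ^ N)) M *
      (P (a * q * q ^ i) j * ((- (1 / (a * q ^ N) * q ^ M)) ^ j * qtri q j))"
    unfolding M0(1) qpoch_add
    using qpoch_reflect[of "1 / (a * q ^ N) * q ^ M" "a * q * q ^ i" q j] q0 nz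
    by (simp add: M)
  have s7: "P (A / (a' * q ^ j)) j = P (a' * q / A) j * ((- (A / (a' * q ^ j))) ^ j * qtri q j)"
    using qpoch_reflect[of "A / (a' * q ^ j)" "a' * q / A" q j] q0 nz nz' by simp
  define X where "X = q ^ M"
  have pw: "(- 1) ^ j * qtri q j * q ^ j * ((- (A / (a' * q ^ j))) ^ j * qtri q j) *
      (- (1 / (a * q ^ N) * X)) ^ j = (- (eta * X)) ^ j"
  proof -
    have "(- 1) ^ j * qtri q j * q ^ j * ((- (A / (a' * q ^ j))) ^ j * qtri q j) * (- (1 / (a * q ^ N) * X)) ^ j =
      (qtri q j * qtri q j * q ^ j) * ((- 1) * (- (A / (a' * q ^ j))) * (- (1 / (a * q ^ N) * X))) ^ j"
      by (simp only: power_mult_distrib mult_ac)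
    also have "qtri q j * qtri q j * q ^ j = (q ^ j) ^ j" by (simp add: qtri_square power_mult)
    also have "(q ^ j) ^ j * ((- 1) * (- (A / (a' * q ^ j))) * (- (1 / (a * q ^ N) * X))) ^ j = (- (eta * X)) ^ j"
      unfolding power_mult_distrib[symmetric]
      by (rule arg_cong[where f = "\<lambda>z. z ^ j"]) (use q0 nz in \<open>simp add: eta_def a' power2_eq_square mult_ac\<close>)
    finally show ?thesis .
  qed
  have nonz: "P (A * d / a) j \<noteq> 0" "P (A * e / a) j \<noteq> 0" "P (A * d / a * q ^ j) M \<noteq> 0" "P (A * e / a * q ^ j) M \<noteq> 0"
    "P (a' * q / A) j \<noteq> 0" "P d' j \<noteq> 0" "P e' j \<noteq> 0"
    "P (f * q * q ^ i) j \<noteq> 0" "P (A * q * q ^ N / q ^ i) j \<noteq> 0" "P (a * q * q ^ i) j \<noteq> 0"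
    "P (1 / (a * q ^ N)) M \<noteq> 0" "P (a' * q) j \<noteq> 0" "P (a' * q * q ^ j) j \<noteq> 0" "P (a' * q * q ^ (2 * j)) M \<noteq> 0"
    "X \<noteq> 0" "eta \<noteq> 0"
  proof -
    have "A * q * q ^ N / q ^ i = A * q ^ Suc (N - i)"
      using q0 by (simp add: M M0 power_add)
    then show "P (A * d / a) j \<noteq> 0" "P (A * e / a) j \<noteq> 0" "P (A * d / a * q ^ j) M \<noteq> 0" "P (A * e / a * q ^ j) M \<noteq> 0"
      "P (a' * q / A) j \<noteq> 0" "P d' j \<noteq> 0" "P e' j \<noteq> 0"
      "P (f * q * q ^ i) j \<noteq> 0" "P (A * q * q ^ N / q ^ i) j \<noteq> 0" "P (a * q * q ^ i) j \<noteq> 0"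
      "P (1 / (a * q ^ N)) M \<noteq> 0" "P (a' * q) j \<noteq> 0" "P (a' * q * q ^ j) j \<noteq> 0" "P (a' * q * q ^ (2 * j)) M \<noteq> 0"
      "X \<noteq> 0" "eta \<noteq> 0"
      using P_inv_a[of M] P_Ad[of 0 j] P_Ae[of 0 j] P_Ad[of j M] P_Ae[of j M] P_a'A[of 1 j 0] P_d'[of j] P_e'[of j] P_f[of i j]
        P_A[of "Suc (N - i)" j] P_a[of "Suc i" j] P_a'[of 1 j] P_a'[of "Suc j" j] P_a'[of "Suc (2 * j)" M] q0 nz assms
      by (auto simp: X_def eta_def mult_ac)
  qed
  \<comment> \<open>A rational identity in opaque variables, whose hypotheses are then matched with
    the relations above.\<close>
  have gen: "tp / (p1 * p2) * (t * S) * (u1 / v1) * (u2 / v2) * (x7 / p3) * (u3 / v3) * (u4 / v4) *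
      (s1b * yM * eM * dM / (adM * aeM * a2M * aM)) =
    tp * (Aq * Y * Dd * Ee) / (AD * AE * B1 * Na) * (u3 * u1 * u2 * u4 / (f1 * b1 * d1 * e1))"
    if "S * s1b = Aq * v4" "v1 * adM = AD" "v2 * aeM = AE" "d1 * dM = Dd" "e1 * eM = Ee"
      "p1 * p3 * a2M = B1 * b1" "Y = yM * (f1 * (Z * T))" "Na = aM * (v3 * (W * T))" "x7 = p2 * (W' * T)"
      "t * (W' * T) * W = Z"
      and "p2 \<noteq> 0" "d1 \<noteq> 0" "e1 \<noteq> 0" "f1 \<noteq> 0" "v4 \<noteq> 0" "W \<noteq> 0" "T \<noteq> 0"
    for tp p1 p2 t S u1 v1 u2 v2 x7 p3 u3 v3 u4 v4 s1b yM eM dM adM aeM a2M aM Aq Y Dd Ee AD AE B1 Na f1 b1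
      d1 e1 Z T W W' :: complex
  proof -
    have "tp / (p1 * p2) * (t * S) * (u1 / v1) * (u2 / v2) * (x7 / p3) * (u3 / v3) * (u4 / v4) *
      (s1b * yM * eM * dM / (adM * aeM * a2M * aM)) =
      tp * (S * s1b) * t * x7 * u1 * u2 * u3 * u4 * yM * eM * dM /
      ((p1 * p3 * a2M) * p2 * (v1 * adM) * (v2 * aeM) * v3 * v4 * aM)"
      by (simp add: mult_ac)
    also have "\<dots> = tp * Aq * t * (W' * T) * u1 * u2 * u3 * u4 * yM * eM * dM / (B1 * b1 * AD * AE * v3 * aM)"
      unfolding that(1-3,6,9) using that(11,15) by (simp add: mult_ac)
    also have "\<dots> = tp * Aq * (t * (W' * T) * W) * u1 * u2 * u3 * u4 * yM * eM * dM / (B1 * b1 * AD * AE * v3 * aM * W)"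
      using that(16) by (simp add: mult_ac)
    also have "\<dots> = tp * (Aq * Y * Dd * Ee) / (AD * AE * B1 * Na) * (u3 * u1 * u2 * u4 / (f1 * b1 * d1 * e1))"
      unfolding that(10) that(4,5)[symmetric] that(7,8) using that(12,13,14,17) by (simp add: mult_ac)
    finally show ?thesis .
  qed
  have W0: "(- (1 / (a * q ^ N) * q ^ M)) ^ j \<noteq> 0" using q0 nz by simp
  show ?thesis
    unfolding moment_const_def chi_moment_def moment_ratio_def
    by (rule gen[OF s1 s2(1,2,3,4) s3 s5 s6 s7 pw[unfolded X_def] nonz(5,6,7,8,9) W0 qtri_nz[OF q0]])
qed

text \<open>Only \<open>j \<le> k \<le> N - i\<close> contributes: \<open>P (1 / q ^ k) j\<close>
  vanishes below this range and \<open>P (q ^ k / q ^ N) i\<close> above it. If the range is empty,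
  the right-hand side vanishes through \<open>P (q ^ i / q ^ N) j\<close>.\<close>

lemma moment:
  assumes "i \<le> N" "j \<le> N"
  shows "(\<Sum>k\<le>N. weight k * chi i k * phi a' j k) = chi_moment i * moment_ratio i j"
proof (cases "i + j \<le> N")
  case True
  define M where "M = N - i - j"
  define g where "g k = weight k * chi i k * phi a' j k" for k
  have "sum g {..N} = sum g {j..j + M}"
  proof (rule sum.mono_neutral_right)
    show "\<forall>k\<in>{..N} - {j..j + M}. g k = 0"
    proof
      fix k assume "k \<in> {..N} - {j..j + M}"
      then consider "k < j" | "k \<le> N" "N < k + i" using True by (force simp: M_def)
      then show "g k = 0"
      proof cases
        case 1
        then have "P (1 / q ^ k) j = 0" using q0 by (auto simp: qpoch_def)
        then show ?thesis by (simp add: g_def phi_def)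
      next
        case 2
        then have "P (q ^ k / q ^ N) i = 0"
          using q0 by (auto simp: qpoch_def simp flip: power_add intro!: bexI[of _ "N - k"])
        then show ?thesis by (simp add: g_def chi_def)
      qed
    qed
  qed (use True in \<open>auto simp: M_def\<close>)
  also have "\<dots> = (\<Sum>l\<le>M. g (j + l))"
    using sum.shift_bounds_cl_nat_ivl[of g 0 j M] by (simp add: atLeast0AtMost add.commute)
  also have "\<dots> = (\<Sum>l\<le>M. moment_const i j * vwp q (A * q ^ (2 * j)) [a * q * q ^ j / d, a * q * q ^ j / e, A / a',
      A * q ^ j / (a * q ^ i), 1 / q ^ M] l)"
    unfolding g_def M_def by (intro sum.cong refl term_product) (use True in auto)
  also have "\<dots> = moment_const i j * (P (A * q * q ^ (2 * j)) M * P eta M * P (e' * q ^ j) M * P (d' * q ^ j) M /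
      (P (A * d / a * q ^ j) M * P (A * e / a * q ^ j) M * P (a' * q * q ^ (2 * j)) M * P (1 / (a * q ^ N)) M))"
    proof -
    have "P (A * d / a * q ^ j) M * P (A * e / a * q ^ j) M * P (a' * q * q ^ (2 * j)) M * P (1 / (a * q ^ N)) M \<noteq> 0"
      using P_Ad[of j M] P_Ae[of j M] P_a'[of "Suc (2 * j)" M] P_inv_a[of M] True by (auto simp: M_def mult_ac)
    from nonzero_eq_divide_eq[OF this, THEN iffD2, OF moment_jackson[OF True, folded M_def]]
    show ?thesis unfolding sum_distrib_left[symmetric] by simp
  qed
  finally show ?thesis
    using moment_simplify[OF True] by (simp add: g_def M_def)
next
  case False
  have "g = 0" if "g = weight k * chi i k * phi a' j k" "k \<le> N" for g k
  proof (cases "k < j")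
    case True
    then have "P (1 / q ^ k) j = 0" using q0 by (auto simp: qpoch_def)
    then show ?thesis by (simp add: that phi_def)
  next
    case f: False
    then have "P (q ^ k / q ^ N) i = 0"
      using q0 False that by (auto simp: qpoch_def simp flip: power_add intro!: bexI[of _ "N - k"])
    then show ?thesis by (simp add: that chi_def)
  qed
  then have "(\<Sum>k\<le>N. weight k * chi i k * phi a' j k) = 0" by (intro sum.neutral) auto
  moreover have "P (q ^ i / q ^ N) j = 0"
    using q0 False assms by (auto simp: qpoch_def simp flip: power_add intro!: bexI[of _ "N - i"])
  ultimately show ?thesis by (simp add: moment_ratio_def)
qed

section \<open>Biorthogonality\<close>

text \<open>The factor of the \<open>j\<close>-th term of \<open>V\<close> that does not depend on
  x.\<close>

definition V_coeff :: "nat \<Rightarrow> nat \<Rightarrow> complex" where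
  "V_coeff m j = vwp q a' [d', e', a' * q * q ^ N, f * q ^ m, 1 / q ^ m] j"

text \<open>The sum over \<open>j\<close> in the case \<open>i = m = n\<close>, with products of
  length \<open>n\<close> where possible, as they occur in \<open>C\<close>.\<close>

definition diag_sum :: "nat \<Rightarrow> complex" where
  "diag_sum n = P (a' * q) n / P (a' * q * q ^ (N - n)) n *
     (P (A * q * q ^ (N - n) / (a * q ^ n)) n / P (A * q / (a * q ^ n)) n) *
     (P (f * q * q ^ (2 * n)) (N - n) / P (f * q * q ^ n) (N - n)) * (P q n / P (q * q ^ (N - n)) n)"

lemma V_coeff_eq_0: "m < j \<Longrightarrow> V_coeff m j = 0"
proof -
  assume "m < j"
  then have "P (1 / q ^ m) j = 0" using q0 by (auto simp: qpoch_def)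
  then show ?thesis by (simp add: V_coeff_def vwp_Cons)
qed

text \<open>\<open>d'\<close>, \<open>e'\<close> and their partners \<open>a * q / e\<close>,
  \<open>a * q / d\<close> cancel, which leaves a very-well-poised term with five parameters, ready
  for Jackson's sum.\<close>

lemma V_coeff_moment_ratio:
  assumes "i \<le> N" "j \<le> N"
  shows "V_coeff m j * moment_ratio i j =
    vwp q a' [1 / q ^ m, f * q ^ m, A / (a * q ^ i), a' * q * q ^ N, 1 / q ^ (N - i)] j"
proof -
  have qi: "q ^ i / q ^ N = 1 / q ^ (N - i)" using q0 assms by (simp add: power_diff)
  have 1: "a' * q / d' = a * q / e" "a' * q / e' = a * q / d" "a' * q / (A / (a * q ^ i)) = f * q * q ^ i"
    "a' * q / (1 / q ^ (N - i)) = a' * q * q ^ (N - i)"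
    using q0 nz by (simp_all add: a' d' e' f power2_eq_square mult_ac)
  have "P d' j \<noteq> 0" "P e' j \<noteq> 0" "P (a * q / d) j \<noteq> 0" "P (a * q / e) j \<noteq> 0"
    using P_d' P_e' P_ad P_ae assms by auto
  moreover have "B * m * g * n * (ee / ad) * (dd / ae) * (t1 * ad * ae * t2 / (F * G * dd * ee)) =
      B * (t2 / G) * n * (t1 / F) * g * m" if "dd \<noteq> 0" "ee \<noteq> 0" "ad \<noteq> 0" "ae \<noteq> 0"
    for B m g n ee ad dd ae t1 t2 F G :: complex
    using that by (simp add: mult_ac)
  ultimately show ?thesis
    unfolding V_coeff_def moment_ratio_def vwp_Cons 1 qi by blast
qed

text \<open>Jackson's sum is applied with length \<open>N - i\<close> although the series stops at \<open>m\<close>: length \<open>m\<close> would need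
  \<open>f q\<^sup>k \<noteq> 1\<close> beyond \<open>k = N\<close>, which is not assumed. For \<open>m = 0\<close> a denominator may vanish.\<close>

lemma sum_moment_ratio:
  assumes "i \<le> m" "m \<le> N" "0 < m"
  defines "M \<equiv> N - i"
  shows "(\<Sum>j\<le>m. V_coeff m j * moment_ratio i j) *
      (P (a' * q * q ^ m) M * P (A * q / (a * q ^ m)) M * P (f * q * q ^ i) M * P (q * q ^ i) M) =
    P (a' * q) M * P (A * q / a) M * P (f * q * q ^ i * q ^ m) M * P (q * q ^ i / q ^ m) M"
    and "P (a' * q * q ^ m) M * P (A * q / (a * q ^ m)) M * P (f * q * q ^ i) M * P (q * q ^ i) M \<noteq> 0"
proof -
  have M: "q ^ N = q ^ i * q ^ M" using assms by (simp flip: power_add)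
  have iN: "i \<le> N" using assms by simp
  define g where "g j = vwp q a' [1 / q ^ m, f * q ^ m, A / (a * q ^ i), a' * q * q ^ N, 1 / q ^ M] j" for j
  \<comment> \<open>The terms vanish beyond \<open>m\<close> as well as beyond \<open>N - i\<close>;
    passing through \<open>N\<close> avoids comparing the two bounds.\<close>
  have "(\<Sum>j\<le>m. V_coeff m j * moment_ratio i j) = (\<Sum>j\<le>N. V_coeff m j * moment_ratio i j)"
    using assms by (intro sum.mono_neutral_left) (auto simp: V_coeff_eq_0)
  also have "\<dots> = (\<Sum>j\<le>N. g j)"
    using iN by (intro sum.cong) (simp_all add: V_coeff_moment_ratio g_def M_def)
  also have "\<dots> = (\<Sum>j\<le>M. g j)"
  proof (intro sum.mono_neutral_right ballI)
    fix j assume "j \<in> {..N} - {..M}"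
    then have "P (1 / q ^ M) j = 0" using q0 by (auto simp: qpoch_def)
    then show "g j = 0" by (simp add: g_def vwp_Cons)
  qed (auto simp: M_def)
  finally have S: "(\<Sum>j\<le>m. V_coeff m j * moment_ratio i j) = (\<Sum>j\<le>M. g j)" .
  have 1: "a' * q / (1 / q ^ m) = a' * q * q ^ m" "a' * q / (f * q ^ m) = A * q / (a * q ^ m)"
    "a' * q / (A / (a * q ^ i)) = f * q * q ^ i" "a' * q / (a' * q * q ^ N) = 1 / q ^ N"
    "a' * q / (1 / q ^ m * (f * q ^ m)) = A * q / a"
    "a' * q / (1 / q ^ m * (A / (a * q ^ i))) = f * q * q ^ i * q ^ m"
    "a' * q / (f * q ^ m * (A / (a * q ^ i))) = q * q ^ i / q ^ m"
    "a' * q / (1 / q ^ m * (f * q ^ m) * (A / (a * q ^ i))) = q * q ^ i"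
    using q0 nz by (simp_all add: a' f power2_eq_square field_simps)
  have bal: "1 / q ^ m * (f * q ^ m) * (A / (a * q ^ i)) * (a' * q * q ^ N) = a'\<^sup>2 * q ^ Suc M"
    using q0 nz by (simp add: a' f M power2_eq_square field_simps)
  have d1: "P (a' * q * q ^ m) M \<noteq> 0" using P_a'[of "Suc m" M] assms by (auto simp: mult_ac)
  have d3: "P (f * q * q ^ i) M \<noteq> 0" using P_f[of i M] assms by auto
  have d4: "P (1 / q ^ N) M \<noteq> 0" using P_qN[of M 0] assms by auto
  have d5: "P (q * q ^ i) M \<noteq> 0"
    using P_q[of "i + M"] by (simp add: qpoch_add)
  \<comment> \<open>\<open>Suc l\<close> may reach \<open>N\<close>, outside the range of
    \<open>aA\<close>; cancelling one \<open>q\<close>, possible as \<open>0 < m\<close>, brings it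
    back.\<close>
  have d2: "P (A * q / (a * q ^ m)) M \<noteq> 0"
    unfolding qpoch_nz_iff
  proof (intro allI impI notI)
    fix l assume l: "l < M" "A * q / (a * q ^ m) * q ^ l = 1"
    then have eq: "A * q ^ Suc l = a * q ^ m" using q0 nz by (simp add: field_simps)
    have "q ^ m = q * q ^ (m - 1)" using assms by (cases m) auto
    with eq have "A * q ^ l = a * q ^ (m - 1)" using q0 by (auto simp: mult_ac)
    moreover have "l < N" "m - 1 \<le> N" using l assms by auto
    ultimately show False using aA[of "m - 1" l] by auto
  qed
  show "P (a' * q * q ^ m) M * P (A * q / (a * q ^ m)) M * P (f * q * q ^ i) M * P (q * q ^ i) M \<noteq> 0"
    using d1 d2 d3 d5 by simp
  have a'k: "a' * q ^ k \<noteq> 1" if "k \<le> 2 * M" for k using a'1[of k] that by (simp add: M_def)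
  have "(\<Sum>j\<le>M. g j) * qpochs q [a' * q * q ^ m, A * q / (a * q ^ m), f * q * q ^ i, q * q ^ i] M =
    qpochs q [a' * q, A * q / a, f * q * q ^ i * q ^ m, q * q ^ i / q ^ m] M"
    unfolding g_def
    by (rule jackson_sum[of q a' "1 / q ^ m" "f * q ^ m" "A / (a * q ^ i)" "a' * q * q ^ N" M, unfolded 1])
      (use q0 nz nz' bal P_q a'k d1 d2 d3 d4 in auto)
  then show "(\<Sum>j\<le>m. V_coeff m j * moment_ratio i j) *
      (P (a' * q * q ^ m) M * P (A * q / (a * q ^ m)) M * P (f * q * q ^ i) M * P (q * q ^ i) M) =
    P (a' * q) M * P (A * q / a) M * P (f * q * q ^ i * q ^ m) M * P (q * q ^ i / q ^ m) M"
    unfolding S qpochs_Cons by (simp add: mult.assoc)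
qed

text \<open>On the right of \<open>sum_moment_ratio\<close> the factor of
  \<open>P (q * q ^ i / q ^ m) (N - i)\<close> at index \<open>m - i - 1\<close> is zero;
  \<open>m \<le> N\<close> puts this index in range.\<close>

lemma sum_moment_ratio_eq_0:
  assumes "i < m" "m \<le> N"
  shows "(\<Sum>j\<le>m. V_coeff m j * moment_ratio i j) = 0"
proof -
  have "q * q ^ i / q ^ m * q ^ (m - i - 1) = 1"
    using assms q0 by (simp flip: power_add power_Suc)
  moreover have "m - i - 1 < N - i" using assms by auto
  ultimately have "P (q * q ^ i / q ^ m) (N - i) = 0"
    using qpoch_nz_iff by blast
  then show ?thesis using sum_moment_ratio[of i m] assms by auto
qed

lemma qpoch_swap_length:
  assumes "P (x * q ^ i) k \<noteq> 0" "P (x * q ^ k) i \<noteq> 0"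
  shows "P x k / P (x * q ^ i) k = P x i / P (x * q ^ k) i"
  using qpoch_shift_up[of q x i k] by (simp only: frac_eq_eq[OF assms] mult.commute)

text \<open>\<open>sum_moment_ratio\<close> at \<open>i = m = n\<close>; three of the four quotients
  of length \<open>N - n\<close> are exchanged for quotients of length \<open>n\<close>.\<close>

lemma sum_moment_ratio_diag:
  assumes "n \<le> N"
  shows "(\<Sum>j\<le>n. V_coeff n j * moment_ratio n j) = diag_sum n"
proof (cases "n = 0")
  \<comment> \<open>\<open>sum_moment_ratio\<close> needs a positive index; for \<open>n = 0\<close>
    both sides are 1.\<close>
  case True
  have "V_coeff 0 0 * moment_ratio 0 0 = 1" using a'1[of 0] by (simp add: V_coeff_def moment_ratio_def vwp_def qpochs_def)
  moreover have "P (f * q) N \<noteq> 0" using P_f[of 0 N] by simp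
  ultimately show ?thesis using True by (simp add: diag_sum_def)
next
  case False
  define M where "M = N - n"
  note S = sum_moment_ratio[of n n, folded M_def, OF order_refl assms False[unfolded neq0_conv]]
  have q2: "f * q * q ^ n * q ^ n = f * q * q ^ (2 * n)" by (simp add: q_double)
  have nz1: "P (a' * q * q ^ n) M \<noteq> 0" "P (A * q / (a * q ^ n)) M \<noteq> 0" "P (f * q * q ^ n) M \<noteq> 0"
    "P (q * q ^ n) M \<noteq> 0" using S(2) by auto
  have 1: "P (a' * q) M / P (a' * q * q ^ n) M = P (a' * q) n / P (a' * q * q ^ M) n"
    using P_a'[of "Suc M" n] nz1 assms by (intro qpoch_swap_length) (auto simp: M_def mult_ac)
  have 4: "P q M / P (q * q ^ n) M = P q n / P (q * q ^ M) n"
    using P_q[of "M + n"] nz1 by (intro qpoch_swap_length) (auto simp: qpoch_add)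
  define x where "x = A * q / (a * q ^ n)"
  have xn: "P x n \<noteq> 0"
    unfolding qpoch_nz_iff x_def
  proof (intro allI impI notI)
    fix l assume l: "l < n" "A * q / (a * q ^ n) * q ^ l = 1"
    then have eq: "A * q ^ Suc l = a * q ^ n" using q0 nz by (simp add: field_simps)
    have "q ^ n = q * q ^ (n - 1)" using False by (cases n) auto
    with eq have "A * q ^ l = a * q ^ (n - 1)" using q0 by (auto simp: mult_ac)
    moreover have "l < N" "n - 1 \<le> N" using l assms by auto
    ultimately show False using aA[of "n - 1" l] by auto
  qed
  have 2: "P (A * q / a) M / P x M = P (x * q ^ M) n / P x n"
  proof -
    have "A * q / a = x * q ^ n" using q0 by (simp add: x_def)
    then show ?thesis
      using qpoch_shift_up[of q x n M] xn nz1(2)[folded x_def] by (simp add: frac_eq_eq mult.commute)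
  qed
  have "(\<Sum>j\<le>n. V_coeff n j * moment_ratio n j) = P (a' * q) M * P (A * q / a) M * P (f * q * q ^ n * q ^ n) M * P (q * q ^ n / q ^ n) M
     / (P (a' * q * q ^ n) M * P x M * P (f * q * q ^ n) M * P (q * q ^ n) M)"
    using nonzero_eq_divide_eq[OF S(2), THEN iffD2, OF S(1)] unfolding x_def .
  also have "\<dots> = P (a' * q) M / P (a' * q * q ^ n) M * (P (A * q / a) M / P x M) *
     (P (f * q * q ^ (2 * n)) M / P (f * q * q ^ n) M) * (P q M / P (q * q ^ n) M)"
    unfolding q2 using q0 by simp
  also have "\<dots> = diag_sum n" unfolding 1 2 4 unfolding diag_sum_def M_def[symmetric] x_def by simp
  finally show ?thesis .
qed

definition V_sum :: "nat \<Rightarrow> nat \<Rightarrow> complex" where "V_sum m k = (\<Sum>j\<le>m. V_coeff m j * phi a' j k)"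

lemma moment_V:
  assumes "i \<le> m" "m \<le> N"
  shows "(\<Sum>k\<le>N. weight k * chi i k * V_sum m k) = chi_moment i * (\<Sum>j\<le>m. V_coeff m j * moment_ratio i j)"
proof -
  have "(\<Sum>k\<le>N. weight k * chi i k * V_sum m k) = (\<Sum>j\<le>m. V_coeff m j * (\<Sum>k\<le>N. weight k * chi i k * phi a' j k))"
    unfolding V_sum_def sum_distrib_left by (subst sum.swap) (simp add: mult_ac)
  also have "\<dots> = (\<Sum>j\<le>m. V_coeff m j * (chi_moment i * moment_ratio i j))"
    using assms by (intro sum.cong refl arg_cong2[where f = "(*)"] moment) auto
  finally show ?thesis by (simp add: sum_distrib_left mult_ac)
qed

section \<open>Polynomials in x and the expansion of \<open>phi\<close> in
  \<open>chi\<close>\<close>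

text \<open>With \<open>A = \<mu> * b^2\<close>, \<open>xval (q ^ k)\<close> is the point x_k
  multiplied by 2/b.\<close>

definition xval :: "complex \<Rightarrow> complex" where "xval t = t + 1 / (A * t)"

definition lin :: "complex \<Rightarrow> complex poly" where "lin c = [:1 + c\<^sup>2 / A, - c:]"

text \<open>\<open>phi a n\<close> and \<open>chi n\<close> are the quotients of
  \<open>plin A n\<close> and \<open>plin (1 / q ^ N) n\<close> by the same polynomial
  \<open>plin (a * q) n\<close>.\<close>

definition plin :: "complex \<Rightarrow> nat \<Rightarrow> complex poly" where "plin c n = (\<Prod>l<n. lin (c * q ^ l))"

lemma poly_lin: "t \<noteq> 0 \<Longrightarrow> poly (lin c) (xval t) = (1 - c * t) * (1 - c / (A * t))"
proof -
  assume t: "t \<noteq> 0"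
  have "(c * t) * (c / (A * t)) = c\<^sup>2 / A" using t by (simp add: power2_eq_square)
  moreover have "(1 - x) * (1 - y) = 1 + x * y - (x + y)" for x y :: complex
    by (simp add: algebra_simps)
  moreover have "poly (lin c) (xval t) = 1 + c\<^sup>2 / A - (c * t + c / (A * t))"
    by (simp add: lin_def xval_def ring_distribs mult.commute)
  ultimately show ?thesis by metis
qed

lemma poly_plin: "t \<noteq> 0 \<Longrightarrow> poly (plin c n) (xval t) = P (c * t) n * P (c / (A * t)) n"
  by (simp add: plin_def poly_prod poly_lin qpoch_def prod.distrib mult_ac)

lemma degree_plin: "degree (plin c n) \<le> n"
proof (induction n)
  case (Suc n)
  have "plin c (Suc n) = plin c n * lin (c * q ^ n)" by (simp add: plin_def)
  moreover have "degree (lin (c * q ^ n)) \<le> 1" by (simp add: lin_def)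
  ultimately show ?case using degree_mult_le[of "plin c n" "lin (c * q ^ n)"] Suc by auto
qed (simp add: plin_def)

text \<open>The root of \<open>lin (a * q ^ n)\<close>, which for \<open>n > 0\<close> is the last
  factor of \<open>plin (a * q) n\<close>.\<close>

definition node :: "nat \<Rightarrow> complex" where "node n = xval (1 / (a * q ^ n))"

text \<open>These are the two factors of the numerator of \<open>chi n\<close> at
  \<open>node n\<close>; that they do not vanish allows the top coefficient to be solved
  for.\<close>

lemma chi_node_nz:
  assumes "n \<le> N"
  shows "P (1 / (a * q ^ N * q ^ n)) n \<noteq> 0" "P (a * q ^ n / (A * q ^ N)) n \<noteq> 0"
proof -
  show "P (1 / (a * q ^ N * q ^ n)) n \<noteq> 0"
    unfolding qpoch_nz_iff
  proof (intro allI impI notI)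
    fix l assume l: "l < n" "1 / (a * q ^ N * q ^ n) * q ^ l = 1"
    have n: "q ^ n = q ^ (n - l) * q ^ l" using l(1) by (simp flip: power_add)
    have "a * q ^ (N + (n - l)) = 1" using l(2) q0 nz unfolding n by (simp add: power_add field_simps)
    then show False using a1[of "N + (n - l)"] assms by simp
  qed
  show "P (a * q ^ n / (A * q ^ N)) n \<noteq> 0"
    unfolding qpoch_nz_iff
  proof (intro allI impI notI)
    fix l assume l: "l < n" "a * q ^ n / (A * q ^ N) * q ^ l = 1"
    then have eq: "a * q ^ (n + l) = A * q ^ N" using q0 nz by (simp add: power_add field_simps)
    show False
    \<comment> \<open>The smaller power of \<open>q\<close> is cancelled, so that both exponents lie
      in the range of \<open>aA\<close>.\<close>
    proof (cases "n + l \<le> N")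
      case True
      then have "q ^ N = q ^ (n + l) * q ^ (N - (n + l))" by (simp flip: power_add)
      then have "a * q ^ 0 = A * q ^ (N - (n + l))" using eq q0 by simp
      then show False using aA[of 0 "N - (n + l)"] l(1) assms by simp
    next
      case False
      then have "q ^ (n + l) = q ^ N * q ^ (n + l - N)" by (simp flip: power_add)
      then have "a * q ^ (n + l - N) = A * q ^ 0" using eq q0 by simp
      moreover have "n + l - N \<le> N" "0 < N" using l(1) assms by linarith+
      ultimately show False using aA[of "n + l - N" 0] by simp
    qed
  qed
qed

text \<open>A multiple of the numerator of \<open>chi (Suc n)\<close> is subtracted so that the rest
  vanishes at the node. The rest is then divisible by the last denominator factor, and the quotient
  has degree at most \<open>n\<close> over \<open>plin (a * q) n\<close>.\<close>

lemma chi_expansion: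
  assumes "n \<le> N" "degree p \<le> n"
  shows "\<exists>\<kappa>. (\<forall>k\<le>N. poly p (xval (q ^ k)) / poly (plin (a * q) n) (xval (q ^ k)) = (\<Sum>l\<le>n. \<kappa> l * chi l k)) \<and>
    \<kappa> n * poly (plin (1 / q ^ N) n) (node n) = poly p (node n)"
  using assms
proof (induction n arbitrary: p)
  case 0
  then obtain c where "p = [:c:]" by (auto elim: degree_eq_zeroE)
  then show ?case by (intro exI[of _ "\<lambda>_. c"]) (simp add: plin_def chi_def)
next
  case (Suc n)
  define Q where "Q = plin (1 / q ^ N) (Suc n)"
  define x where "x = node (Suc n)"
  define c where "c = a * q * q ^ n"
  have c0: "c \<noteq> 0" using nz q0 by (simp add: c_def)
  have Qx: "poly Q x \<noteq> 0"
    using chi_node_nz[OF Suc.prems(1)] nz q0 unfolding Q_def x_def node_def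
    by (subst poly_plin) (simp_all add: mult_ac)
  define p1 where "p1 = p - smult (poly p x / poly Q x) Q"
  have "poly p1 x = 0" using Qx by (simp add: p1_def)
  then obtain p2 where p2: "p1 = [:- x, 1:] * p2" by (auto simp: poly_eq_0_iff_dvd)
  have xc: "x = 1 / c + c / A" using nz q0 by (simp add: x_def node_def xval_def c_def mult_ac)
  have lin_c: "lin c = smult (- c) [:- x, 1:]"
    using c0 by (simp add: lin_def xc power2_eq_square algebra_simps)
  define p3 where "p3 = smult (- 1 / c) p2"
  have p13: "p1 = lin c * p3"
  proof -
    have "smult (- c) L * smult (- 1 / c) p2 = L * p2" for L
      using c0 by (simp only: mult_smult_left mult_smult_right smult_smult) simp
    then show ?thesis unfolding lin_c p2 p3_def ..
  qed
  have deg1: "degree p1 \<le> Suc n"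
    unfolding p1_def Q_def using Suc.prems(2) degree_plin
    by (intro degree_diff_le order_trans[OF degree_smult_le]) auto
  have "degree p3 \<le> n"
  proof (cases "p2 = 0")
    case False
    then have "degree p1 = Suc (degree p2)" unfolding p2 by (subst degree_mult_eq) auto
    then show ?thesis using deg1 by (simp add: p3_def)
  qed (simp add: p3_def)
  with Suc obtain \<kappa> where \<kappa>: "\<And>k. k \<le> N \<Longrightarrow> poly p3 (xval (q ^ k)) / poly (plin (a * q) n) (xval (q ^ k)) = (\<Sum>l\<le>n. \<kappa> l * chi l k)"
    by (metis Suc_leD)
  define \<kappa>' where "\<kappa>' = \<kappa>(Suc n := poly p x / poly Q x)"
  have "poly p (xval (q ^ k)) / poly (plin (a * q) (Suc n)) (xval (q ^ k)) = (\<Sum>l\<le>Suc n. \<kappa>' l * chi l k)" if "k \<le> N" for k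
  proof -
    let ?xval = "xval (q ^ k)"
    have D: "poly (plin (a * q) (Suc n)) ?xval = poly (plin (a * q) n) ?xval * poly (lin c) ?xval"
      by (simp add: plin_def c_def)
    have nz2: "poly (plin (a * q) (Suc n)) ?xval \<noteq> 0"
      using q0 P_a[of "Suc k" "Suc n"] P_aA[of 1 "Suc n" k] that Suc.prems(1)
      by (subst poly_plin) (auto simp: mult_ac)
    have chi_eq: "chi (Suc n) k = poly Q ?xval / poly (plin (a * q) (Suc n)) ?xval"
      using q0 unfolding Q_def by (subst (1 2) poly_plin) (simp_all add: chi_def mult_ac)
    have "p = p1 + smult (poly p x / poly Q x) Q" by (simp add: p1_def)
    then have "poly p ?xval = poly p1 ?xval + poly p x / poly Q x * poly Q ?xval"
      by (metis poly_add poly_smult)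
    then have "poly p ?xval / poly (plin (a * q) (Suc n)) ?xval =
        poly p1 ?xval / poly (plin (a * q) (Suc n)) ?xval + poly p x / poly Q x * chi (Suc n) k"
      unfolding chi_eq by (simp add: add_divide_distrib)
    also have "poly p1 ?xval / poly (plin (a * q) (Suc n)) ?xval = poly p3 ?xval / poly (plin (a * q) n) ?xval"
      using nz2 unfolding D p13 by simp
    also have "\<dots> = (\<Sum>l\<le>n. \<kappa>' l * chi l k)" unfolding \<kappa>[OF that] by (intro sum.cong) (auto simp: \<kappa>'_def)
    finally show ?thesis by (simp add: \<kappa>'_def)
  qed
  moreover have "\<kappa>' (Suc n) * poly Q x = poly p x" using Qx by (simp add: \<kappa>'_def)
  ultimately show ?case unfolding Q_def x_def by blast
qed

text \<open>The quotient of the numerators of \<open>phi a n\<close> and \<open>chi n\<close> at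
  \<open>node n\<close>.\<close>

definition chi_lead :: "nat \<Rightarrow> complex" where
  "chi_lead n = P (a * q ^ n) n * P (A / (a * q ^ n)) n / (P (1 / (a * q ^ N * q ^ n)) n * P (a * q ^ n / (A * q ^ N)) n)"

lemma phi_expansion:
  assumes "n \<le> N"
  shows "\<exists>\<kappa>. (\<forall>k\<le>N. phi a n k = (\<Sum>l\<le>n. \<kappa> l * chi l k)) \<and> \<kappa> n = chi_lead n"
proof -
  obtain \<kappa> where \<kappa>: "\<And>k. k \<le> N \<Longrightarrow> poly (plin A n) (xval (q ^ k)) / poly (plin (a * q) n) (xval (q ^ k)) = (\<Sum>l\<le>n. \<kappa> l * chi l k)"
    "\<kappa> n * poly (plin (1 / q ^ N) n) (node n) = poly (plin A n) (node n)"
    using chi_expansion[OF assms degree_plin] by blast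
  have "phi a n k = poly (plin A n) (xval (q ^ k)) / poly (plin (a * q) n) (xval (q ^ k))" for k
    using q0 nz by (subst (1 2) poly_plin) (simp_all add: phi_def mult_ac)
  moreover have "poly (plin A n) (node n) = P (a * q ^ n) n * P (A / (a * q ^ n)) n"
    "poly (plin (1 / q ^ N) n) (node n) = P (1 / (a * q ^ N * q ^ n)) n * P (a * q ^ n / (A * q ^ N)) n"
    using q0 nz unfolding node_def by (subst poly_plin; simp add: mult_ac)+
  then have "\<kappa> n = chi_lead n"
    using \<kappa>(2) chi_node_nz[OF assms] by (simp add: chi_lead_def field_simps)
  ultimately show ?thesis using \<kappa>(1) by auto
qed

text \<open>\<open>phi a i\<close> is a combination of the \<open>chi l\<close> with
  \<open>l \<le> i \<le> m\<close>, and \<open>V_sum m\<close> annihilates all of these except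
  \<open>l = m\<close>.\<close>

lemma phi_V:
  assumes "i \<le> m" "m \<le> N"
  shows "(\<Sum>k\<le>N. weight k * phi a i k * V_sum m k) = (if i = m then chi_lead m * chi_moment m * diag_sum m else 0)"
proof -
  obtain \<kappa> where \<kappa>: "\<And>k. k \<le> N \<Longrightarrow> phi a i k = (\<Sum>l\<le>i. \<kappa> l * chi l k)" "\<kappa> i = chi_lead i"
    using phi_expansion[of i] assms by auto
  have "(\<Sum>k\<le>N. weight k * phi a i k * V_sum m k) = (\<Sum>k\<le>N. weight k * (\<Sum>l\<le>i. \<kappa> l * chi l k) * V_sum m k)"
    using \<kappa>(1) by (intro sum.cong) auto
  also have "\<dots> = (\<Sum>l\<le>i. \<kappa> l * (\<Sum>k\<le>N. weight k * chi l k * V_sum m k))"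
    unfolding sum_distrib_left sum_distrib_right by (subst sum.swap) (simp add: mult_ac)
  also have "\<dots> = (\<Sum>l\<le>i. if l = m then \<kappa> l * (chi_moment l * diag_sum l) else 0)"
  proof (intro sum.cong refl)
    fix l assume l: "l \<in> {..i}"
    show "\<kappa> l * (\<Sum>k\<le>N. weight k * chi l k * V_sum m k) = (if l = m then \<kappa> l * (chi_moment l * diag_sum l) else 0)"
      using l assms moment_V[of l m] sum_moment_ratio_eq_0[of l m] sum_moment_ratio_diag[of m] by auto
  qed
  also have "\<dots> = (if i = m then chi_lead m * chi_moment m * diag_sum m else 0)"
    using assms \<kappa>(2) by (auto simp: mult_ac)
  finally show ?thesis .
qed

definition U_coeff :: "nat \<Rightarrow> nat \<Rightarrow> complex" where
  "U_coeff n i = vwp q a [d, e, a * q * q ^ N, f * q ^ n, 1 / q ^ n] i"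

definition U_sum :: "nat \<Rightarrow> nat \<Rightarrow> complex" where "U_sum n k = (\<Sum>i\<le>n. U_coeff n i * phi a i k)"

lemma orthogonal:
  assumes "n \<le> m" "m \<le> N"
  shows "(\<Sum>k\<le>N. weight k * U_sum n k * V_sum m k) = (if n = m then U_coeff n n * chi_lead n * chi_moment n * diag_sum n else 0)"
proof -
  have "(\<Sum>k\<le>N. weight k * U_sum n k * V_sum m k) = (\<Sum>i\<le>n. U_coeff n i * (\<Sum>k\<le>N. weight k * phi a i k * V_sum m k))"
    unfolding U_sum_def sum_distrib_left sum_distrib_right by (subst sum.swap) (simp add: mult_ac)
  also have "\<dots> = (\<Sum>i\<le>n. if i = m then U_coeff n i * (chi_lead m * chi_moment m * diag_sum m) else 0)"
    using assms by (intro sum.cong refl) (auto simp: phi_V)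
  also have "\<dots> = (if n = m then U_coeff n n * chi_lead n * chi_moment n * diag_sum n else 0)"
    using assms by (auto simp: mult_ac)
  finally show ?thesis .
qed

interpretation D: wilson q A a' d' e' a d e f N by (rule dual)

lemma biorthogonal:
  assumes "n \<le> N" "m \<le> N"
  shows "(\<Sum>k\<le>N. weight k * U_sum n k * V_sum m k) = (if n = m then U_coeff n n * chi_lead n * chi_moment n * diag_sum n else 0)"
proof (cases "n \<le> m")
  case False
  have 1: "a' * q / d' = a * q / e" "a' * q / e' = a * q / d"
    using q0 nz by (simp_all add: a' d' e')
  \<comment> \<open>The dual weight has the same parameters in another order.\<close>
  have weight: "D.weight k = weight k" for k unfolding weight_def D.weight_def vwp_Cons 1 by (simp only: mult_ac)
  have "D.U_sum m k = V_sum m k" "D.V_sum n k = U_sum n k" for k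
    by (simp_all add: D.U_sum_def D.V_sum_def U_sum_def V_sum_def U_coeff_def V_coeff_def D.U_coeff_def D.V_coeff_def)
  with D.orthogonal[of m n] False assms show ?thesis by (simp add: weight mult_ac)
qed (use orthogonal assms in auto)

section \<open>The normalisation\<close>

definition weight_norm :: complex where
  "weight_norm = P (a * q) N * P (A * d / a) N * P (A * e / a) N * P (d * e / (a * q)) N /
    (P (A * q) N * P d N * P e N * P eta N)"

text \<open>The last \<open>n\<close> factors are split off and reflected.\<close>

lemma P_tail:
  assumes "x \<noteq> 0" "n \<le> N"
  shows "P x N = P x (N - n) * (P (q / (x * q ^ N)) n * ((- (x * q ^ (N - n))) ^ n * qtri q n))"
proof -
  have N: "q ^ N = q ^ (N - n) * q ^ n" using assms by (simp flip: power_add)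
  have "P x N = P x (N - n) * P (x * q ^ (N - n)) n"
    using qpoch_add[of q x "N - n" n] assms by simp
  also have "P (x * q ^ (N - n)) n = P (q / (x * q ^ N)) n * ((- (x * q ^ (N - n))) ^ n * qtri q n)"
    using assms q0 by (intro qpoch_reflect) (simp_all add: N)
  finally show ?thesis .
qed

lemma P_eta: "P eta N \<noteq> 0"
proof -
  have "P eta N = P (f * q) N * ((- eta) ^ N * qtri q N)"
    using q0 nz by (intro qpoch_reflect) (simp_all add: eta_def f power2_eq_square)
  then show ?thesis using P_f[of 0 N] q0 nz qtri_nz[OF q0] by (simp add: eta_def)
qed

text \<open>Splitting the products of length \<open>N\<close> by \<open>P_tail\<close> makes all
  products of length \<open>N - n\<close> cancel against those of
  \<open>chi_moment n\<close>.\<close>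

lemma weight_norm_chi_moment:
  assumes n: "n \<le> N"
  shows "weight_norm * chi_moment n = P (1 / q ^ N) n * P (a * q / (A * d * q ^ N)) n * P (a * q / (A * e * q ^ N)) n *
    P (d * e / (a * q)) n / (P (a * q / A) n * P (f * q) n * P d n * P e n)"
proof -
  define M where "M = N - n"
  define T where "T x = (- (x * q ^ M)) ^ n * qtri q n" for x
  have eta0: "eta \<noteq> 0" using q0 nz by (simp add: eta_def)
  have tl: "P x N = P x M * (P x' n * T x)" if "x \<noteq> 0" "x' = q / (x * q ^ N)" for x x'
    using P_tail[OF that(1) n] unfolding T_def M_def that(2) .
  have t1: "P (A * q) N = P (A * q) M * (P (1 / (A * q ^ N)) n * T (A * q))"
    using q0 nz by (intro tl) auto
  have t2: "P eta N = P eta M * (P (f * q) n * T eta)"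
    using q0 nz by (intro tl) (auto simp: f eta_def power2_eq_square)
  have t3: "P d' N = P d' M * (P d n * T d')" "P e' N = P e' M * (P e n * T e')"
    using q0 nz by (auto intro!: tl simp: d' e')
  have t4: "P (A * d / a) N = P (A * d / a) M * (P (a * q / (A * d * q ^ N)) n * T (A * d / a))"
    "P (A * e / a) N = P (A * e / a) M * (P (a * q / (A * e * q ^ N)) n * T (A * e / a))"
    using q0 nz by (auto intro!: tl)
  have t5: "P (a' * q) N = P (a' * q) M * (P (d * e / (a * q)) n * T (a' * q))"
    using q0 nz nz' by (intro tl) (auto simp: a')
  have t6: "P (1 / (a * q ^ N)) N = P (1 / (a * q ^ N)) M * (P (a * q) n * T (1 / (a * q ^ N)))"
    using q0 nz by (intro tl) auto
  \<comment> \<open>\<open>weight_norm\<close> contains \<open>d\<close>, \<open>e\<close>,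
    \<open>a * q\<close> and \<open>d * e / (a * q)\<close>, while \<open>chi_moment\<close>
    contains their reflections; this passes from one set to the other at full length.\<close>
  have E: "P (a * q) N * P (d * e / (a * q)) N * P d' N * P e' N =
      P (1 / (a * q ^ N)) N * P (a' * q) N * P d N * P e N"
  proof -
    have re: "P x N = P x' N * ((- x) ^ N * qtri q N)" if "x * x' * q ^ N = q" for x x'
      using that q0 by (rule qpoch_reflect)
    have 1: "P (a * q) N = P (1 / (a * q ^ N)) N * ((- (a * q)) ^ N * qtri q N)"
      "P (d * e / (a * q)) N = P (a' * q) N * ((- (d * e / (a * q))) ^ N * qtri q N)"
      "P d N = P d' N * ((- d) ^ N * qtri q N)" "P e N = P e' N * ((- e) ^ N * qtri q N)"
      using q0 nz by (auto intro!: re simp: a' d' e')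
    have 2: "(- (a * q)) ^ N * (- (d * e / (a * q))) ^ N = (- d) ^ N * (- e) ^ N"
      unfolding power_mult_distrib[symmetric] using q0 nz by simp
    have "P (1 / (a * q ^ N)) N * z1 * (P (a' * q) N * z2) * P d' N * P e' N =
      P (1 / (a * q ^ N)) N * P (a' * q) N * (P d' N * z3) * (P e' N * z4)" if "z1 * z2 = z3 * z4" for z1 z2 z3 z4
    proof -
      have "P (1 / (a * q ^ N)) N * z1 * (P (a' * q) N * z2) * P d' N * P e' N =
        P (1 / (a * q ^ N)) N * P (a' * q) N * P d' N * P e' N * (z1 * z2)" by (simp only: mult_ac)
      then show ?thesis unfolding that by (simp only: mult_ac)
    qed
    moreover have "((- (a * q)) ^ N * qtri q N) * ((- (d * e / (a * q))) ^ N * qtri q N) =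
       ((- d) ^ N * qtri q N) * ((- e) ^ N * qtri q N)"
    proof -
      have "(x1 * t) * (x2 * t) = (x1 * x2) * (t * t)" for x1 x2 t :: complex by (simp only: mult_ac)
      then show ?thesis using 2 by simp
    qed
    ultimately show ?thesis unfolding 1 by blast
  qed
  \<comment> \<open>Each \<open>T\<close> is an \<open>n\<close>-th power up to a common factor, so
    it suffices that the four arguments on each side have the same product.\<close>
  have Tm: "T (A * d / a) * T (A * e / a) * T (a' * q) * T (1 / (a * q ^ N)) = T (A * q) * T eta * T d' * T e'"
  proof -
    have mul: "T x1 * T x2 * T x3 * T x4 = ((x1 * x2 * x3 * x4) * (q ^ M * q ^ M * q ^ M * q ^ M)) ^ n *
        (qtri q n * qtri q n * qtri q n * qtri q n)" for x1 x2 x3 x4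
    proof -
      have "T x1 * T x2 * T x3 * T x4 =
        ((- (x1 * q ^ M)) * (- (x2 * q ^ M)) * (- (x3 * q ^ M)) * (- (x4 * q ^ M))) ^ n *
        (qtri q n * qtri q n * qtri q n * qtri q n)"
        unfolding T_def by (simp only: power_mult_distrib mult_ac)
      also have "(- (x1 * q ^ M)) * (- (x2 * q ^ M)) * (- (x3 * q ^ M)) * (- (x4 * q ^ M)) =
        (x1 * x2 * x3 * x4) * (q ^ M * q ^ M * q ^ M * q ^ M)" by (simp add: mult_ac)
      finally show ?thesis .
    qed
    have "(A * d / a) * (A * e / a) * (a' * q) * (1 / (a * q ^ N)) = (A * q) * eta * d' * e'"
      using q0 nz by (simp add: a' eta_def d' e' power2_eq_square field_simps)
    then show ?thesis unfolding mul by simp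
  qed
  have nonz: "P (A * q) N \<noteq> 0" "P eta N \<noteq> 0" "P d' N \<noteq> 0" "P e' N \<noteq> 0" "P d N \<noteq> 0" "P e N \<noteq> 0"
    "P (A * d / a) N \<noteq> 0" "P (A * e / a) N \<noteq> 0" "P (a' * q) N \<noteq> 0" "P (1 / (a * q ^ N)) N \<noteq> 0"
    using P_A[of 1 N] P_eta P_d' P_e' P_d P_e P_Ad[of 0 N] P_Ae[of 0 N] P_a'[of 1 N] P_inv_a by auto
  have gen: "aN * (z4 * (x4 * T4)) * (z5 * (x5 * T5)) * dN / ((z1 * (x1 * T1)) * d0 * e0 * (z2 * (x2 * T2))) *
       ((x0 * x1) / (x7 * xA) * (z1 * z2 * z3 * z3') / (z4 * z5 * z6 * z7)) =
      x0 * x4 * x5 * x6 / (xA * x2 * x3 * x3')"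
    if "aN * dN * (z3 * (x3 * T3)) * (z3' * (x3' * T3')) = (z7 * (x7 * T7)) * (z6 * (x6 * T6)) * d0 * e0"
      "T4 * T5 * T6 * T7 = T1 * T2 * T3 * T3'"
      and "z1 * (x1 * T1) \<noteq> 0" "z2 * (x2 * T2) \<noteq> 0" "z3 * (x3 * T3) \<noteq> 0" "z3' * (x3' * T3') \<noteq> 0" "d0 \<noteq> 0" "e0 \<noteq> 0"
      "z4 * (x4 * T4) \<noteq> 0" "z5 * (x5 * T5) \<noteq> 0" "z6 * (x6 * T6) \<noteq> 0" "z7 * (x7 * T7) \<noteq> 0"
    for aN z4 x4 T4 z5 x5 T5 dN z1 x1 T1 d0 e0 z2 x2 T2 x0 x7 xA z3 z3' z6 z7 x6 x3 x3' T3 T3' T6 T7 :: complex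
  proof -
    have "aN * (z4 * (x4 * T4)) * (z5 * (x5 * T5)) * dN / ((z1 * (x1 * T1)) * d0 * e0 * (z2 * (x2 * T2))) *
       ((x0 * x1) / (x7 * xA) * (z1 * z2 * z3 * z3') / (z4 * z5 * z6 * z7)) =
      (aN * dN * (z3 * (x3 * T3)) * (z3' * (x3' * T3'))) * x4 * x5 * T4 * T5 * x0 /
        (d0 * e0 * T1 * x2 * T2 * x7 * xA * z6 * z7 * x3 * T3 * x3' * T3')"
      using that(3-) by (simp add: mult_ac)
    also have "\<dots> = (T4 * T5 * T6 * T7) * x6 * x4 * x5 * x0 / (T1 * x2 * T2 * xA * x3 * T3 * x3' * T3')"
      unfolding that(1) using that(3-) by (simp add: mult_ac)
    also have "\<dots> = x0 * x4 * x5 * x6 / (xA * x2 * x3 * x3')"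
      unfolding that(2) using that(3-) by (simp add: mult_ac)
    finally show ?thesis .
  qed
  show ?thesis
    unfolding weight_norm_def chi_moment_def chi_const_def M_def[symmetric]
    unfolding t1 t2 t4
    by (rule gen[OF E[unfolded t3 t5 t6] Tm nonz(1)[unfolded t1] nonz(2)[unfolded t2] nonz(3)[unfolded t3]
      nonz(4)[unfolded t3] nonz(5,6) nonz(7)[unfolded t4] nonz(8)[unfolded t4] nonz(9)[unfolded t5] nonz(10)[unfolded t6]])
qed

text \<open>The constant \<open>C\<close> written in \<open>A\<close>, \<open>a'\<close> and
  \<open>f\<close>.\<close>

definition norm_const :: "nat \<Rightarrow> complex" where
  "norm_const n = 1 / q ^ n * (P q n * P (a * q / (A * d * q ^ N)) n * P (a * q / (A * e * q ^ N)) n *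
      P (f * q * q ^ N) n * P (a' * q) n * P (a * q) n /
    (P (1 / q ^ N) n * P (a' / A) n * P (a * q / d) n * P (a * q / e) n * P (a / A) n * P (f * q) n)) *
    ((1 - f * q ^ n) / (1 - f * q ^ (2 * n)))"

text \<open>\<open>F1\<close> and \<open>F2\<close> merge the factors in \<open>a\<close> and
  \<open>f\<close>, the reflections \<open>r1\<close> to \<open>r8\<close> bring the others to the
  form in \<open>norm_const\<close>, and \<open>pw\<close> balances the reflection factors.\<close>

lemma norm_eq:
  assumes n: "n \<le> N" and f2: "1 - f * q ^ (2 * n) \<noteq> 0"
  shows "weight_norm * (U_coeff n n * chi_lead n * chi_moment n * diag_sum n) = norm_const n"
proof -
  define M where "M = N - n"
  have qN: "q ^ N = q ^ M * q ^ n" using n by (simp add: M_def flip: power_add)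
  define T where "T x = (- x) ^ n * qtri q n" for x
  have re: "P x n = P x' n * T x" if "x * x' * q ^ n = q" for x x'
    unfolding T_def using that q0 by (rule qpoch_reflect)
  have T0: "T x \<noteq> 0" if "x \<noteq> 0" for x using that qtri_nz[OF q0] by (simp add: T_def)
  \<comment> \<open>Both sides times \<open>1 - a\<close> are
    \<open>P a (Suc (2 * n))\<close>.\<close>
  have F1: "(1 - a * q ^ (2 * n)) / (1 - a) * P a n * P (a * q ^ n) n = P (a * q) n * P (a * q * q ^ n) n"
  proof -
    have "(1 - a) * (P (a * q) n * P (a * q * q ^ n) n) = P a (Suc (2 * n))"
      by (simp add: qpoch_Suc_left[of q a] qpoch_add[of q _ n n] mult_2)
    also have "\<dots> = (1 - a * q ^ (2 * n)) * (P a n * P (a * q ^ n) n)"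
      by (simp add: qpoch_Suc qpoch_add[of q _ n n] mult_2)
    finally show ?thesis using a1[of 0] by (simp add: field_simps)
  qed
  \<comment> \<open>Both sides are \<open>P (f * q ^ n) (N + 1)\<close>, split in two ways.\<close>
  have F2: "P (f * q ^ n) n * (1 - f * q ^ (2 * n)) * P (f * q * q ^ (2 * n)) M =
      (1 - f * q ^ n) * P (f * q * q ^ n) M * P (f * q * q ^ N) n"
  proof -
    have "P (f * q ^ n) n * (1 - f * q ^ (2 * n)) * P (f * q * q ^ (2 * n)) M = P (f * q ^ n) (Suc n + M)"
      unfolding qpoch_add q_double by (simp add: qpoch_Suc power_add mult_ac)
    also have "Suc n + M = Suc (M + n)" by simp
    also have "P (f * q ^ n) \<dots> = (1 - f * q ^ n) * P (f * q * q ^ n) M * P (f * q * q ^ N) n"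
      by (simp add: qpoch_Suc_left qpoch_add qN mult_ac)
    finally show ?thesis .
  qed
  have r1: "P (a * q / (f * q ^ n)) n = P (a' / A) n * T (a * q / (f * q ^ n))"
    using q0 nz by (intro re) (simp add: a' f power2_eq_square field_simps)
  have r2: "P (1 / (a * q ^ N * q ^ n)) n = P (a * q * q ^ N) n * T (1 / (a * q ^ N * q ^ n))"
    using q0 nz by (intro re) simp
  have r3: "P (a * q ^ n / (A * q ^ N)) n = P (A * q * q ^ M / (a * q ^ n)) n * T (a * q ^ n / (A * q ^ N))"
    using q0 nz by (intro re) (simp add: qN)
  have r4: "P (A / (a * q ^ n)) n = P (a * q / A) n * T (A / (a * q ^ n))"
    using q0 nz by (intro re) simp
  have r5: "P (A * q / (a * q ^ n)) n = P (a / A) n * T (A * q / (a * q ^ n))"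
    using q0 nz by (intro re) simp
  have r6: "P (1 / q ^ n) n = P q n * T (1 / q ^ n)" using q0 by (intro re) simp
  have r7: "P (1 / q ^ N) n = P (q * q ^ M) n * T (1 / q ^ N)" using q0 by (intro re) (simp add: qN)
  have r8: "P (d * e / (a * q)) n = P (a' * q * q ^ M) n * T (d * e / (a * q))"
    using q0 nz by (intro re) (simp add: a' qN)
  have pw: "T (1 / q ^ n) * T (A / (a * q ^ n)) * T (d * e / (a * q)) * T (1 / q ^ N) * (q ^ n * q ^ n) =
      T (a * q / (f * q ^ n)) * T (1 / (a * q ^ N * q ^ n)) * T (a * q ^ n / (A * q ^ N)) * T (A * q / (a * q ^ n))"
  proof -
    have mul: "T x1 * T x2 * T x3 * T x4 = (x1 * x2 * x3 * x4) ^ n *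
        (qtri q n * qtri q n * qtri q n * qtri q n)" for x1 x2 x3 x4
    proof -
      have "T x1 * T x2 * T x3 * T x4 = ((- x1) * (- x2) * (- x3) * (- x4)) ^ n *
        (qtri q n * qtri q n * qtri q n * qtri q n)"
        unfolding T_def by (simp only: power_mult_distrib mult_ac)
      then show ?thesis by simp
    qed
    \<comment> \<open>Drawing \<open>q ^ n * q ^ n\<close> into the \<open>n\<close>-th power
      reduces the claim to an identity of bases.\<close>
    have sq: "x ^ n * t * (q ^ n * q ^ n) = (x * (q * q)) ^ n * t" for x t
      by (simp only: power_mult_distrib mult_ac)
    have "(1 / q ^ n) * (A / (a * q ^ n)) * (d * e / (a * q)) * (1 / q ^ N) * (q * q) =
      (a * q / (f * q ^ n)) * (1 / (a * q ^ N * q ^ n)) * (a * q ^ n / (A * q ^ N)) * (A * q / (a * q ^ n))"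
      using q0 nz by (simp add: f power2_eq_square field_simps)
    then show ?thesis unfolding mul sq by (simp only:)
  qed
  have gen: "c * (An / Qn) * qn * (o_n / an1) * (fn / af) * (aN / oN) * (E / ae) * (D / ad) * (an * k1 / (k2 * k3)) *
      (oN * x1 * x2 * x8 / (aA * fq * D * E)) * (a'q / am * (k4 / k5) * (g1 / g2) * (Qn / qm)) =
     1 / qn * (Qn * x1 * x2 * fN * a'q * aq / (oN * aA2 * ad * ae * a_A * fq)) * (h1 / h2)"
    if F: "c * An * an = aq * an1" "fn * h2 * g1 = h1 * g2 * fN"
      and rel: "af = aA2 * p1" "k2 = aN * p2" "k3 = k4 * p3" "k1 = aA * p4" "k5 = a_A * p5" "o_n = Qn * p6"
        "oN = qm * p7" "x8 = am * p8"
      and p: "p6 * p4 * p8 * p7 * (qn * qn) = p1 * p2 * p3 * p5"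
      and z: "an \<noteq> 0" "an1 \<noteq> 0" "D \<noteq> 0" "E \<noteq> 0" "aN \<noteq> 0" "oN \<noteq> 0" "aA \<noteq> 0" "k4 \<noteq> 0" "g2 \<noteq> 0" "am \<noteq> 0" "Qn \<noteq> 0" "h2 \<noteq> 0"
        "qn \<noteq> 0" "p1 \<noteq> 0" "p2 \<noteq> 0" "p3 \<noteq> 0" "p5 \<noteq> 0"
    for c An an aq an1 fn h2 g1 h1 g2 fN af aA2 p1 k2 aN p2 k3 k4 p3 k1 aA p4 k5 a_A p5 o_n Qn p6 oN qm p7 x8 am p8
      qn D E x1 x2 fq ad ae a'q :: complex
  proof -
    have "c * (An / Qn) * qn * (o_n / an1) * (fn / af) * (aN / oN) * (E / ae) * (D / ad) * (an * k1 / (k2 * k3)) *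
      (oN * x1 * x2 * x8 / (aA * fq * D * E)) * (a'q / am * (k4 / k5) * (g1 / g2) * (Qn / qm)) =
      (c * An * an) * (fn * h2 * g1) * qn * o_n * aN * k1 * x1 * x2 * x8 * a'q * k4 /
      (h2 * an1 * af * ae * ad * k2 * k3 * aA * fq * am * k5 * g2 * qm)"
      using z by (simp add: mult_ac)
    also have "\<dots> = aq * h1 * fN * qn * Qn * x1 * x2 * a'q * (p6 * p4 * p8 * p7 * (qn * qn)) /
      (h2 * aA2 * ae * ad * fq * a_A * (qm * p7) * (p1 * p2 * p3 * p5) * (qn * qn))"
      unfolding F rel(1-6,8) using z rel(7) by (simp add: mult_ac)
    also have "\<dots> = 1 / qn * (Qn * x1 * x2 * fN * a'q * aq / (oN * aA2 * ad * ae * a_A * fq)) * (h1 / h2)"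
      unfolding p rel(7)[symmetric] using z by (simp add: mult_ac)
    finally show ?thesis .
  qed
  have 1: "a * q / (a * q * q ^ N) = 1 / q ^ N" "a * q / (1 / q ^ n) = a * q * q ^ n"
    using q0 nz by simp_all
  have nonz: "P (a * q ^ n) n \<noteq> 0" "P (a * q * q ^ n) n \<noteq> 0" "P d n \<noteq> 0" "P e n \<noteq> 0" "P (a * q * q ^ N) n \<noteq> 0"
    "P (1 / q ^ N) n \<noteq> 0" "P (a * q / A) n \<noteq> 0" "P (A * q * q ^ M / (a * q ^ n)) n \<noteq> 0"
    "P (f * q * q ^ n) M \<noteq> 0" "P (a' * q * q ^ M) n \<noteq> 0" "P q n \<noteq> 0"
    using P_a[of n n] P_a[of "Suc n" n] P_d P_e P_a[of "Suc N" n] P_qN[of n 0] P_aA[of 1 n 0] chi_node_nz[OF n]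
      P_f[of n M] P_a'[of "Suc M" n] P_q n unfolding r3 by (auto simp: M_def mult_ac)
  have Tz: "T (a * q / (f * q ^ n)) \<noteq> 0" "T (1 / (a * q ^ N * q ^ n)) \<noteq> 0" "T (a * q ^ n / (A * q ^ N)) \<noteq> 0"
    "T (A * q / (a * q ^ n)) \<noteq> 0" "q ^ n \<noteq> 0"
    using q0 nz nz' by (auto intro!: T0)
  have "weight_norm * (U_coeff n n * chi_lead n * chi_moment n * diag_sum n) = U_coeff n n * chi_lead n * (weight_norm * chi_moment n) * diag_sum n" by (simp only: mult_ac)
  also have "\<dots> = norm_const n"
    unfolding weight_norm_chi_moment[OF n] U_coeff_def vwp_Cons vwp_Nil chi_lead_def diag_sum_def norm_const_def M_def[symmetric] 1
    by (rule gen[OF F1 F2 r1 r2 r3 r4 r5 r6 r7 r8 pw nonz f2 Tz(5) Tz(1,2,3,4)])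
  finally show ?thesis .
qed

theorem biorthogonal_normalized:
  assumes "n \<le> N" "m \<le> N" "1 - f * q ^ (2 * n) \<noteq> 0"
  shows "(\<Sum>k\<le>N. weight_norm * weight k * U_sum n k * V_sum m k) = (if n = m then norm_const n else 0)"
proof -
  have "(\<Sum>k\<le>N. weight_norm * weight k * U_sum n k * V_sum m k) = weight_norm * (\<Sum>k\<le>N. weight k * U_sum n k * V_sum m k)"
    by (simp add: sum_distrib_left mult_ac)
  then show ?thesis unfolding biorthogonal[OF assms(1,2)] using norm_eq[OF assms(1,3)] by auto
qed

end

section \<open>From the series to the sums\<close>

lemma qpochs_nz_iff: "qpochs q xs k \<noteq> 0 \<longleftrightarrow> (\<forall>x\<in>set xs. qpoch q x k \<noteq> 0)"
  by (auto simp: qpochs_def prod_list_zero_iff)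

lemma qpochs_0 [simp]: "qpochs q xs 0 = 1"
  by (induction xs) (simp_all add: qpochs_Cons)

lemma W109_eq_sum_vwp:
  assumes "q \<noteq> 0" "q powi (- int n) \<in> set ps"
  shows "W109 q a ps = (\<Sum>k\<le>n. vwp q a ps k)"
  unfolding W109_terminating[OF assms] vwp_def ..

text \<open>For \<open>x = c\<close> and \<open>x = - c\<close> the quotient of
  \<open>qpoch q (q * x) k\<close> by \<open>qpoch q x k\<close> collapses to
  \<open>(1 - x * q ^ k) / (1 - x)\<close>. The square roots in \<open>r\<close> thus form the
  very-well-poised factor.\<close>

lemma qpoch_sqrt_quotient:
  assumes "qpoch q c k \<noteq> 0" "qpoch q (- c) k \<noteq> 0" "c\<^sup>2 \<noteq> 1"
  shows "qpoch q (q * c) k * qpoch q (- q * c) k / (qpoch q c k * qpoch q (- c) k) =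
    (1 - c\<^sup>2 * q ^ (2 * k)) / (1 - c\<^sup>2)"
proof -
  have 1: "(1 - x) * qpoch q (q * x) k = qpoch q x k * (1 - x * q ^ k)" for x
    using qpoch_Suc_left[of q x k] by (simp add: qpoch_Suc mult.commute)
  have "(1 - c\<^sup>2) * (qpoch q (q * c) k * qpoch q (- q * c) k) =
      ((1 - c) * qpoch q (q * c) k) * ((1 - (- c)) * qpoch q (q * (- c)) k)"
    by (simp add: power2_eq_square algebra_simps)
  also have "\<dots> = (1 - c\<^sup>2 * q ^ (2 * k)) * (qpoch q c k * qpoch q (- c) k)"
    unfolding 1 mult_2 power_add by (simp add: power2_eq_square algebra_simps)
  finally show ?thesis using assms by (simp add: frac_eq_eq mult.commute)
qed

theorem theorem4p1:
  fixes q a b d e \<mu> :: complex and N n m :: nat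
  assumes "0 < norm q" "norm q < 1"
    and "a \<noteq> 0" "b \<noteq> 0" "d \<noteq> 0" "e \<noteq> 0" "\<mu> \<noteq> 0"
    and "no_zero_denominators q N a b d e \<mu>"
    and "n \<le> N" "m \<le> N"
  shows "(\<Sum>k=0..N. U q N a b d e \<mu> n (x_of \<mu> (b * q ^ k)) *
                    V q N a b d e \<mu> m (x_of \<mu> (b * q ^ k)) * r q N a b d e \<mu> k)
         = (if n = m then C q N a b d e \<mu> n else 0)"
proof -
  define A where "A = \<mu> * b\<^sup>2"
  define a' d' e' where "a' = a * q / (d * e * q ^ N)" and "d' = q / (d * q ^ N)" and "e' = q / (e * q ^ N)"
  define f where "f = a\<^sup>2 * q / (A * d * e * q ^ N)"
  have q0: "q \<noteq> 0" and nz: "A \<noteq> 0" "a \<noteq> 0" "d \<noteq> 0" "e \<noteq> 0" using assms by (auto simp: A_def)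
  have qpow: "q ^ k \<noteq> 1" if "0 < k" for k
  proof
    assume "q ^ k = 1"
    then have "norm q ^ k = 1" by (metis norm_power norm_one)
    moreover have "norm q ^ k < 1"
      using power_strict_decreasing[of 0 k "norm q"] assms(1,2) that by simp
    ultimately show False by simp
  qed
  have pw: "q powi (1 - int N) = q / q ^ N" "q powi (2 - int N) = q * q / q ^ N" "q powi (- int k) = 1 / q ^ k"
    "q powi (int N - 1) = q ^ N / q" "q powi (1 - int N + int k) = q * q ^ k / q ^ N"
    "q powi (2 * int k + (1 - int N)) = q * q ^ (2 * k) / q ^ N" for k
    using q0 by (simp_all add: power_int_add power_int_diff power_int_minus power2_eq_square field_simps
        power_int_mult power_mult)
  have pw2: "q powi (1 - int N + 2 * int k) = q * q ^ (2 * k) / q ^ N" for k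
    using pw(6)[of k] by (simp only: add.commute)
  define t where "t k = b * q ^ k" for k
  have t_nz: "t k \<noteq> 0" for k using assms q0 by (simp add: t_def)
  \<comment> \<open>At \<open>t = b * q ^ k\<close> the first two parameters become
    \<open>1 / q ^ k\<close> and \<open>A * q ^ k\<close>.\<close>
  have Up: "U_params q N a b d e \<mu> n (t k) = [1 / q ^ k, A * q ^ k, d, e, a * q * q ^ N, f * q ^ n, 1 / q ^ n]" for n k
    using q0 assms by (simp add: U_params_def t_def A_def f_def pw power2_eq_square mult_ac)
  have Vb: "V_base q N a d e = a'" by (simp add: V_base_def a'_def pw mult_ac)
  have Vp: "V_params q N a b d e \<mu> n (t k) = [1 / q ^ k, A * q ^ k, d', e', a' * q * q ^ N, f * q ^ n, 1 / q ^ n]" for n k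
    using q0 assms by (simp add: V_params_def t_def A_def f_def a'_def d'_def e'_def pw power2_eq_square mult_ac)
  have Udef: "U q N a b d e \<mu> n (x_of \<mu> (t k)) = (\<Sum>i\<le>n. vwp q a
      [1 / q ^ k, A * q ^ k, d, e, a * q * q ^ N, f * q ^ n, 1 / q ^ n] i)" for n k
    unfolding U_x_of[OF assms(7) t_nz] by (subst W109_eq_sum_vwp[where n = n]) (use q0 in \<open>auto simp: Up pw\<close>)
  have Vdef: "V q N a b d e \<mu> n (x_of \<mu> (t k)) = (\<Sum>i\<le>n. vwp q a'
      [1 / q ^ k, A * q ^ k, d', e', a' * q * q ^ N, f * q ^ n, 1 / q ^ n] i)" for n k
    unfolding V_x_of[OF assms(7) t_nz] Vb by (subst W109_eq_sum_vwp[where n = n]) (use q0 in \<open>auto simp: Vp pw\<close>)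
  have nzd: "W109_defined q n a (U_params q N a b d e \<mu> n (t k))"
    "W109_defined q n a' (V_params q N a b d e \<mu> n (t k))"
    "qpochs q (r_den q N a b d e \<mu>) k \<noteq> 0" "qpochs q (r_den_N q a b d e \<mu>) N \<noteq> 0"
    "qpochs q (C_den q N a b d e \<mu>) n \<noteq> 0" "C_den_factor q N a b d e \<mu> n \<noteq> 0" if "n \<le> N" "k \<le> N" for n k
    using assms(8) that unfolding no_zero_denominators_def Vb t_def by auto
  have a10: "1 - a \<noteq> 0" "1 - a' \<noteq> 0"
    using nzd(1,2)[of 0 0] by (auto simp: W109_defined_def)
  have cf: "C_den_factor q N a b d e \<mu> n = 1 - f * q ^ (2 * n)" for n
    unfolding C_den_factor_def f_def A_def pw2 by (simp add: mult_ac)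
  show ?thesis
  \<comment> \<open>For \<open>N = 0\<close> the products in the hypothesis are empty and do not
    imply \<open>A \<noteq> 1\<close>, which the locale demands; there the sum is a single
    term.\<close>
  proof (cases "N = 0")
    case True
    then have "n = 0" "m = 0" using assms by auto
    moreover have "1 - f \<noteq> 0" using nzd(6)[of 0 0] unfolding cf by simp
    moreover have "C q N a b d e \<mu> 0 = (1 - f) / (1 - f)"
      unfolding C_def cf by (simp add: f_def A_def pw(1) mult_ac)
    moreover have "U q N a b d e \<mu> 0 (x_of \<mu> (t 0)) = 1" "V q N a b d e \<mu> 0 (x_of \<mu> (t 0)) = 1"
      using a10 unfolding Udef Vdef by (simp_all add: vwp_def)
    ultimately show ?thesis
      using True by (simp add: t_def r_def)
  next
    case False
    define c where "c = csqrt A"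
    have c2: "c\<^sup>2 = A" by (simp add: c_def)
    have rd: "qpoch q c k \<noteq> 0" "qpoch q (- c) k \<noteq> 0" "qpoch q (a * q) k \<noteq> 0" "qpoch q (A * d / a) k \<noteq> 0"
      "qpoch q (A * e / a) k \<noteq> 0" "qpoch q (A * q * q ^ N) k \<noteq> 0" if "k \<le> N" for k
      using nzd(3)[of 0 k] that unfolding qpochs_nz_iff r_den_def A_def[symmetric] c_def[symmetric]
      by (auto simp: mult_ac)
    have rN: "qpoch q (A * q) N \<noteq> 0" "qpoch q d N \<noteq> 0" "qpoch q e N \<noteq> 0"
      using nzd(4)[of 0 0] unfolding qpochs_nz_iff r_den_N_def A_def[symmetric] by auto
    \<comment> \<open>The longest series, \<open>n = N\<close>, supplies the conditions for all
      indices.\<close>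
    have Ud: "qpoch q (a * q * q ^ k) N \<noteq> 0" "qpoch q (a * q / (A * q ^ k)) N \<noteq> 0"
      "qpoch q (a * q / d) N \<noteq> 0" "qpoch q (a * q / e) N \<noteq> 0" if "k \<le> N" for k
      using nzd(1)[of N k] that unfolding Up W109_defined_def qpochs_nz_iff by auto
    have Vd: "qpoch q (a' * q * q ^ k) N \<noteq> 0" "qpoch q (a' * q / (A * q ^ k)) N \<noteq> 0" if "k \<le> N" for k
      using nzd(2)[of N k] that unfolding Vp W109_defined_def qpochs_nz_iff by auto
    have fN: "qpoch q (f * q) N \<noteq> 0"
      using nzd(5)[of N 0] unfolding qpochs_nz_iff C_den_def pw by (auto simp: f_def A_def mult_ac)
    \<comment> \<open>If \<open>A = 1\<close>, then \<open>csqrt A\<close> or its negative is 1 and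
      a factor in the denominator of \<open>r\<close> vanishes.\<close>
    have A0: "A \<noteq> 1"
    proof
      assume "A = 1"
      then have "c = 1 \<or> c = - 1" using c2 by (simp add: power2_eq_1_iff)
      then show False using rd(1,2)[of N] False unfolding qpoch_nz_iff by auto
    qed
    \<comment> \<open>The range up to \<open>2 * N\<close> is covered by \<open>k = 0\<close> and
      two blocks of length \<open>N\<close>.\<close>
    have three: "x * q ^ k \<noteq> 1" if "x \<noteq> 1" "qpoch q (x * q) N \<noteq> 0" "qpoch q (x * q * q ^ N) N \<noteq> 0" "k \<le> 2 * N" for x k
    proof -
      have "k = 0 \<or> (\<exists>l<N. k = Suc l) \<or> (\<exists>l<N. k = Suc N + l)"
        using that(4) by presburger
      then consider "k = 0" | l where "k = Suc l" "l < N" | l where "k = Suc N + l" "l < N"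
        by blast
      then show ?thesis
        by cases (use that(1-3) in \<open>auto simp: qpoch_nz_iff power_add mult_ac\<close>)
    qed
    \<comment> \<open>The series give \<open>x * q ^ Suc l \<noteq> A * q ^ k\<close> for
      \<open>l < N\<close> and \<open>k \<le> N\<close>. For \<open>i = N\<close> this is used with
      \<open>k = j\<close>, otherwise with both exponents raised by one.\<close>
    have ratio: "x * q ^ i \<noteq> A * q ^ j" if "\<And>k. k \<le> N \<Longrightarrow> qpoch q (x * q / (A * q ^ k)) N \<noteq> 0" "i \<le> N" "j < N" for x i j
    proof
      assume eq: "x * q ^ i = A * q ^ j"
      show False
      proof (cases "i = N")
        case True
        then have "x * q / (A * q ^ j) * q ^ (N - 1) = 1"
          using eq False q0 nz by (cases N) (simp_all add: field_simps)
        moreover have "N - 1 < N" "j \<le> N" using False that by auto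
        ultimately show False using that(1)[of j] unfolding qpoch_nz_iff by blast
      next
        case False
        then have "x * q / (A * q ^ Suc j) * q ^ i = 1" using eq q0 nz by (simp add: field_simps)
        moreover have "i < N" "Suc j \<le> N" using False that by auto
        ultimately show False using that(1)[of "Suc j"] unfolding qpoch_nz_iff by blast
      qed
    qed
    interpret wilson q A a d e a' d' e' f N
    proof
      show "A * q ^ k \<noteq> 1" if "k \<le> 2 * N" for k using three[OF A0 rN(1) rd(6) that] by simp
      show "a * q ^ k \<noteq> 1" if "k \<le> 2 * N" for k
        using three[of a k] a10 Ud(1)[of 0] Ud(1)[of N] that by simp
      show "a' * q ^ k \<noteq> 1" if "k \<le> 2 * N" for k
        using three[of a' k] a10 Vd(1)[of 0] Vd(1)[of N] that by simp
      show "a * q ^ i \<noteq> A * q ^ j" if "i \<le> N" "j < N" for i j using ratio[OF Ud(2) that] .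
      show "a' * q ^ i \<noteq> A * q ^ j" if "i \<le> N" "j < N" for i j using ratio[OF Vd(2) that] .
      show "d * q ^ k \<noteq> 1" "e * q ^ k \<noteq> 1" if "k < N" for k
        using rN that unfolding qpoch_nz_iff by auto
      show "A * d * q ^ k \<noteq> a" "A * e * q ^ k \<noteq> a" if "k < N" for k
        using rd(4,5)[of N] that nz unfolding qpoch_nz_iff by (auto simp: field_simps)
      show "a * q ^ Suc k \<noteq> d" "a * q ^ Suc k \<noteq> e" if "k < N" for k
        using Ud(3,4)[of 0] that nz unfolding qpoch_nz_iff by (auto simp: field_simps)
      show "f * q ^ Suc k \<noteq> 1" if "k < N" for k
        using fN that unfolding qpoch_nz_iff by (auto simp: mult_ac)
    qed (use q0 qpow nz in \<open>auto simp: a'_def d'_def e'_def f_def\<close>)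
    have Ueq: "U q N a b d e \<mu> n (x_of \<mu> (t k)) = U_sum n k" for n k
      unfolding Udef U_sum_def
    proof (intro sum.cong refl)
      fix i
      have "a * q / (1 / q ^ k) = a * q * q ^ k" by simp
      then show "vwp q a [1 / q ^ k, A * q ^ k, d, e, a * q * q ^ N, f * q ^ n, 1 / q ^ n] i = U_coeff n i * phi a i k"
        unfolding vwp_Cons[of q a "1 / q ^ k"] vwp_Cons[of q a "A * q ^ k"] U_coeff_def phi_def by (simp add: mult_ac)
    qed
    have Veq: "V q N a b d e \<mu> n (x_of \<mu> (t k)) = V_sum n k" for n k
      unfolding Vdef V_sum_def
    proof (intro sum.cong refl)
      fix i
      have "a' * q / (1 / q ^ k) = a' * q * q ^ k" by simp
      then show "vwp q a' [1 / q ^ k, A * q ^ k, d', e', a' * q * q ^ N, f * q ^ n, 1 / q ^ n] i = V_coeff n i * phi a' i k"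
        unfolding vwp_Cons[of q a' "1 / q ^ k"] vwp_Cons[of q a' "A * q ^ k"] V_coeff_def phi_def by (simp add: mult_ac)
    qed
    have req: "r q N a b d e \<mu> k = weight_norm * weight k" if "k \<le> N" for k
    proof -
      have 1: "A * d * e / a * (q ^ N / q) = A / a'" "a * (q * q / q ^ N) / (d * e) = a' * q"
        "A * d * e / (a\<^sup>2 * q) = eta"
        using q0 nz by (simp_all add: a'_def eta_def power2_eq_square mult_ac)
      have 2: "A * q / (a * q / d) = A * d / a" "A * q / (a * q / e) = A * e / a" "A * q / (1 / q ^ N) = A * q * q ^ N"
        "A * q / (A / a) = a * q" "A * q / (A / a') = a' * q"
        using q0 nz nz' by simp_all
      have sq: "qpoch q (q * c) k * qpoch q (- q * c) k / (qpoch q c k * qpoch q (- c) k) =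
        (1 - A * q ^ (2 * k)) / (1 - A)"
        using qpoch_sqrt_quotient[of q c k] rd(1,2)[OF that] A0 unfolding c2 by blast
      have "r q N a b d e \<mu> k = q ^ k * ((qpoch q (q * c) k * qpoch q (- q * c) k / (qpoch q c k * qpoch q (- c) k)) *
         (P A k * P (A / a) k * P (a * q / d) k * P (a * q / e) k * P (A / a') k * P (1 / q ^ N) k) /
         (P (a * q) k * P (A * d / a) k * P (A * e / a) k * P (A * q * q ^ N) k * P (a' * q) k * P q k)) * weight_norm"
        unfolding r_def r_den_def r_den_N_def A_def[symmetric] c_def[symmetric] pw 1 qpochs_Cons qpochs_Nil weight_norm_def
          power_add power_one_right
        by (simp add: mult_ac)
      also have "\<dots> = weight_norm * weight k"
        unfolding sq weight_def vwp_Cons 2 vwp_Nil by (simp add: mult_ac)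
      finally show ?thesis .
    qed
    have Ceq: "C q N a b d e \<mu> n = norm_const n"
    proof -
      have "a * (q / q ^ N) / (A * d) = a * q / (A * d * q ^ N)" "a * (q / q ^ N) / (A * e) = a * q / (A * e * q ^ N)"
        "a\<^sup>2 * q\<^sup>2 / (A * d * e) = f * q * q ^ N" "a * (q * q / q ^ N) / (d * e) = a' * q"
        "a * (q / q ^ N) / (A * d * e) = a' / A" "a\<^sup>2 * (q * q / q ^ N) / (A * d * e) = f * q"
        "a\<^sup>2 * (q * q ^ n / q ^ N) / (A * d * e) = f * q ^ n"
        using q0 nz by (simp_all add: a'_def f_def power2_eq_square mult_ac)
      then show ?thesis
        unfolding C_def C_den_def cf A_def[symmetric] pw norm_const_def qpochs_Cons qpochs_Nil by (simp only: mult_1_right mult.assoc)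
    qed
    have "(\<Sum>k=0..N. U q N a b d e \<mu> n (x_of \<mu> (b * q ^ k)) *
                    V q N a b d e \<mu> m (x_of \<mu> (b * q ^ k)) * r q N a b d e \<mu> k) =
      (\<Sum>k\<le>N. weight_norm * weight k * U_sum n k * V_sum m k)"
      unfolding atLeast0AtMost t_def[symmetric] Ueq Veq by (intro sum.cong) (auto simp: req mult_ac)
    then show ?thesis
      using biorthogonal_normalized[OF assms(9,10)] nzd(6)[OF assms(9), of 0] unfolding cf Ceq by simp
  qed
qed

end
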